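(* There exists a universal constant $C>0$ such that, for any two probability distributions $\mu$ and $\nu$ on $\mathbb{R}$ whose moment generating functions are finite everywhere, and for all $1\le p<\infty$, $$W_p(\mu,\nu)\le C\,p\,\sup_{\ell\ge 1}\frac{\Delta_\ell(\mu,\nu)}{\ell},$$ where the supremum is over positive integers $\ell$.
   Context: For distributions $\mu,\nu$ on $\mathbb{R}$ and an integer $\ell\ge1$, $\Delta_\ell(\mu,\nu):=\big|\mathbb{E}[X^\ell]-\mathbb{E}[Y^\ell]\big|^{1/\ell}$ with $X\sim\mu$, $Y\sim\nu$. $W_p(\mu,\nu):=\inf_\gamma\big(\int|x-y|^p\,d\gamma(x,y)\big)^{1/p}$ is the Wasserstein-$p$ distance, the infimum being over all joint distributions $\gamma$ on $\mathbb{R}\times\mathbb{R}$ with first marginal $\mu$ and second marginal $\nu$. *)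

theory Defs
  imports "HOL-Probability.Probability"
begin

definition mgf :: "real measure \<Rightarrow> real \<Rightarrow> ennreal" where
  "mgf \<mu> t = (\<integral>\<^sup>+ x. ennreal (exp (t * x)) \<partial>\<mu>)"

(* Bochner expectations: the value 0 is returned for a moment that does not exist.
   If mgf is finite everywhere, all moments exist. *)
definition moment_dist :: "nat \<Rightarrow> real measure \<Rightarrow> real measure \<Rightarrow> real" where
  "moment_dist l \<mu> \<nu> = root l \<bar>(\<integral>x. x ^ l \<partial>\<mu>) - (\<integral>y. y ^ l \<partial>\<nu>)\<bar>"

definition couplings :: "real measure \<Rightarrow> real measure \<Rightarrow> (real \<times> real) measure set" where
  "couplings \<mu> \<nu> = {\<gamma>. prob_space \<gamma> \<and> sets \<gamma> = sets (borel \<Otimes>\<^sub>M borel) \<and>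
     distr \<gamma> borel fst = \<mu> \<and> distr \<gamma> borel snd = \<nu>}"

(* Real powers on [0, \<infinity>], meant for positive exponents q. *)
definition ennreal_powr :: "ennreal \<Rightarrow> real \<Rightarrow> ennreal" where
  "ennreal_powr x q = (if x = \<top> then \<top> else ennreal (enn2real x powr q))"

definition wasserstein :: "real \<Rightarrow> real measure \<Rightarrow> real measure \<Rightarrow> ennreal" where
  "wasserstein p \<mu> \<nu> = (INF \<gamma> \<in> couplings \<mu> \<nu>.
     ennreal_powr (\<integral>\<^sup>+ (x, y). ennreal (\<bar>x - y\<bar> powr p) \<partial>\<gamma>) (1 / p))"

end

theory Submission
  imports Defs "HOL-Complex_Analysis.Complex_Analysis"
begin

text \<open>
  Let \<open>m\<close> be (slightly more than) the supremum, so that the \<open>l\<close>-th moments of \<open>\<mu>\<close> and \<open>\<nu>\<close>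
  differ by at most \<open>(m l)^l\<close>. Since \<open>l^l / l!\<close> grows only geometrically, a difference of expectations
  of a function \<open>\<Sum> a\<^sub>l x^l\<close> is under control as soon as \<open>l! a\<^sub>l\<close> decays like \<open>c^l\<close> with \<open>c m\<close> small,
  that is, for entire functions of small exponential type. So both measures are first convolved with a
  noise whose density \<open>K\<close> is of this kind, namely a multiple of \<open>(sin (x/w) / (x/w))^q\<close>, with \<open>q\<close> even
  and slightly larger than the exponent of the transport cost, and \<open>w\<close> a large multiple of \<open>q m\<close>.

  The difference of the smoothed densities at \<open>x\<close> is the sum over \<open>l \<ge> 1\<close> of
  the Taylor coefficients of \<open>K\<close> at \<open>x\<close> times moment differences, with alternating signs. Cauchy's estimate on a circle of
  radius about \<open>l w / q\<close> bounds these coefficients, and the bound inherits the decay \<open>(2w/\<bar>x\<bar>)^q\<close> of \<open>K\<close>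
  itself (\<open>norm_sinc_power_coeff_le_decay\<close>). Hence the smoothed densities differ by at most
  a constant times \<open>min 1 ((2w/\<bar>x\<bar>)^q)\<close> (\<open>smoothed_density_diff_le\<close>), a bound whose \<open>n\<close>-th absolute
  moment is of order \<open>w^n\<close>, up to a factor geometric in \<open>n\<close>, for \<open>q = n + 2\<close>.

  On the line such a weighted bound on densities is a bound on transport: the monotone coupling, which
  evaluates both quantile functions at one uniform variable, has \<open>n\<close>-th cost at most
  \<open>2^n \<integral> \<bar>y\<bar>^n \<bar>f y - g y\<bar> dy\<close> (\<open>quantile_distance_le_weighted_density_distance\<close>).
  Undoing the smoothing costs only the \<open>n\<close>-th moment of the noise, again of order \<open>w^n\<close>, because the
  monotone coupling is at least as good as the coupling of \<open>X\<close> with \<open>X + noise\<close>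
  (\<open>quantile_coupling_optimal\<close>). All three steps live on the same uniform variable, so a pointwise
  triangle inequality combines them. As \<open>w\<close> is proportional to
  \<open>n m\<close>, the \<open>n\<close>-th root of the total cost is at most a constant times \<open>n m\<close>; an even \<open>n\<close> between
  \<open>p\<close> and \<open>4 p\<close> gives the claim.
\<close>

section \<open>Quantile functions and the monotone coupling\<close>

text \<open>
  The uniform distribution on the open interval: the endpoints are left out because a quantile at level \<open>0\<close>
  or \<open>1\<close> can be infinite.
\<close>
definition unit_interval :: "real measure" where
  "unit_interval = restrict_space lborel {0<..<1}"

definition quantile :: "real measure \<Rightarrow> real \<Rightarrow> real" where
  "quantile M u = Inf {x. u \<le> cdf M x}"

lemma space_unit_interval [simp]: "space unit_interval = {0<..<1}"
  by (simp add: unit_interval_def space_restrict_space)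

lemma prob_space_unit_interval: "prob_space unit_interval"
  by (auto simp: unit_interval_def emeasure_restrict_space space_restrict_space intro!: prob_spaceI)

text \<open>
  The Galois connection between a distribution function and its generalized inverse. It turns every
  event about quantiles into an interval of the uniform variable.
\<close>
lemma quantile_le_iff:
  assumes "real_distribution M" "0 < u" "u < 1"
  shows "quantile M u \<le> x \<longleftrightarrow> u \<le> cdf M x"
proof -
  interpret cdf_distribution M
    using assms(1) by (simp add: cdf_distribution_def)
  show ?thesis
    unfolding quantile_def by (rule pseudoinverse[OF assms(2,3), symmetric])
qed

lemma measurable_quantile:
  assumes "real_distribution M"
  shows "quantile M \<in> borel_measurable unit_interval"
proof -
  interpret cdf_distribution M
    using assms by (simp add: cdf_distribution_def)
  have "quantile M \<in> borel_measurable (restrict_space borel {0<..<1})"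
    unfolding quantile_def using measurable_CI by simp
  moreover have "sets unit_interval = sets (restrict_space borel {0<..<1::real})"
    unfolding unit_interval_def by (rule sets_restrict_space_cong) simp
  ultimately show ?thesis
    using measurable_cong_sets[OF _ refl] by blast
qed

lemma distr_quantile:
  assumes "real_distribution M"
  shows "distr unit_interval borel (quantile M) = M"
proof -
  interpret cdf_distribution M
    using assms by (simp add: cdf_distribution_def)
  show ?thesis
    using distr_I_eq_M unfolding unit_interval_def quantile_def by simp
qed

lemma emeasure_quantile_between:
  assumes M: "real_distribution M" and N: "real_distribution N"
  shows "emeasure unit_interval {u \<in> space unit_interval. quantile M u \<le> s \<and> t < quantile N u}
    = ennreal (cdf M s - cdf N t)"
proof -
  let ?A = "{0<..<1} \<inter> {cdf N t<..cdf M s}"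
  have iff: "quantile M u \<le> s \<and> t < quantile N u \<longleftrightarrow> u \<in> {cdf N t<..cdf M s}"
    if "0 < u" "u < 1" for u
    using quantile_le_iff[OF M that, of s] quantile_le_iff[OF N that, of t]
    unfolding greaterThanAtMost_iff by linarith
  have "{u \<in> space unit_interval. quantile M u \<le> s \<and> t < quantile N u} = ?A"
  proof (rule set_eqI)
    fix u show "u \<in> {u \<in> space unit_interval. quantile M u \<le> s \<and> t < quantile N u} \<longleftrightarrow> u \<in> ?A"
      using iff[of u] by (cases "0 < u \<and> u < 1") auto
  qed
  then have "emeasure unit_interval {u \<in> space unit_interval. quantile M u \<le> s \<and> t < quantile N u}
      = emeasure unit_interval ?A"
    by simp
  also have "\<dots> = emeasure lborel ?A"
    unfolding unit_interval_def by (rule emeasure_restrict_space) simp_all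
  also have "\<dots> = emeasure lborel {cdf N t<..cdf M s}"
  proof (rule emeasure_eq_AE)
    show "AE u in lborel. (u \<in> ?A) = (u \<in> {cdf N t<..cdf M s})"
      using AE_lborel_singleton[of 1]
    proof eventually_elim
      fix u :: real assume u: "u \<noteq> 1"
      have "0 \<le> cdf N t"
        by (simp add: cdf_def)
      moreover have "cdf M s \<le> 1"
        by (simp add: M real_distribution.cdf_bounded_prob)
      ultimately show "(u \<in> ?A) = (u \<in> {cdf N t<..cdf M s})"
        using u by auto
    qed
  qed simp_all
  also have "\<dots> = ennreal (cdf M s - cdf N t)"
    by (cases "cdf N t \<le> cdf M s") (simp_all add: ennreal_neg)
  finally show ?thesis .
qed

text \<open>
  The integral representation of the convex function \<open>d \<mapsto> (max 0 d)^n\<close> by its second derivative, with the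
  hinge \<open>max 0 (d - r)\<close> written as the length of an interval of thresholds \<open>s\<close>. It reduces the transport
  cost to the probabilities of the events \<open>Z \<le> s, s + r < X\<close>.
\<close>
lemma positive_part_power_layer_cake:
  fixes x z :: real
  assumes n: "2 \<le> n"
  shows "ennreal (max 0 (x - z) ^ n) =
    (\<integral>\<^sup>+ r. ennreal (real n * real (n - 1) * r ^ (n - 2)) * indicator {0..} r *
       (\<integral>\<^sup>+ s. indicator {z..<x - r} s \<partial>lborel) \<partial>lborel)"
proof -
  define d where "d = x - z"
  obtain k where k: "n = Suc (Suc k)"
    using n by (metis add_2_eq_Suc le_Suc_ex)
  have inner: "(\<integral>\<^sup>+ s. indicator {z..<x - r} s \<partial>lborel) = ennreal (d - r)" for r
    by (cases "r \<le> d") (auto simp: d_def ennreal_neg)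
  have eq: "ennreal (real n * real (n - 1) * r ^ (n - 2)) * indicator {0..} r * ennreal (d - r)
      = ennreal (real n * real (n - 1) * r ^ (n - 2) * (d - r)) * indicator {0..d} r" for r
    by (auto split: split_indicator simp: ennreal_neg ennreal_mult[symmetric])
  show ?thesis
  proof (cases "0 \<le> d")
    case True
    have "(\<integral>\<^sup>+ r. ennreal (real n * real (n - 1) * r ^ (n - 2) * (d - r)) * indicator {0..d} r \<partial>lborel)
        = ennreal ((real n * d ^ (n - 1) * d - real (n - 1) * d ^ n)
                   - (real n * 0 ^ (n - 1) * d - real (n - 1) * 0 ^ n))"
    proof (rule nn_integral_FTC_Icc[where F = "\<lambda>r. real n * r ^ (n - 1) * d - real (n - 1) * r ^ n"
          and f = "\<lambda>r. real n * real (n - 1) * r ^ (n - 2) * (d - r)"])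
      fix r assume r: "r \<in> {0..d}"
      show "((\<lambda>r. real n * r ^ (n - 1) * d - real (n - 1) * r ^ n) has_real_derivative
          real n * real (n - 1) * r ^ (n - 2) * (d - r)) (at r)"
        unfolding k
        by (auto simp del: power_Suc intro!: derivative_eq_intros) (simp add: algebra_simps)
      show "0 \<le> real n * real (n - 1) * r ^ (n - 2) * (d - r)"
        using r by (intro mult_nonneg_nonneg) auto
    qed (use True in auto)
    also have "\<dots> = ennreal (d ^ n)"
      by (simp add: k algebra_simps)
    finally show ?thesis
      unfolding inner eq using True by (simp add: d_def)
  next
    case False
    then have "{0..d} = {}" by auto
    then show ?thesis
      unfolding inner eq using False n by (simp add: d_def)
  qed
qed

lemma nn_integral_positive_part_power:
  fixes X Z :: "'a \<Rightarrow> real"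
  assumes "prob_space P" and [measurable]: "X \<in> borel_measurable P" "Z \<in> borel_measurable P"
    and n: "2 \<le> n"
  shows "(\<integral>\<^sup>+ \<omega>. ennreal (max 0 (X \<omega> - Z \<omega>) ^ n) \<partial>P) =
    (\<integral>\<^sup>+ r. ennreal (real n * real (n - 1) * r ^ (n - 2)) * indicator {0..} r *
       (\<integral>\<^sup>+ s. emeasure P {\<omega> \<in> space P. Z \<omega> \<le> s \<and> s + r < X \<omega>} \<partial>lborel) \<partial>lborel)"
proof -
  interpret prob_space P by fact
  interpret pair_sigma_finite P lborel ..
  let ?w = "\<lambda>r. ennreal (real n * real (n - 1) * r ^ (n - 2)) * indicator {0..} r"
  let ?i = "\<lambda>\<omega> r s. indicator {\<omega> \<in> space P. Z \<omega> \<le> s \<and> s + r < X \<omega>} \<omega> :: ennreal"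
  have "(\<integral>\<^sup>+ \<omega>. ennreal (max 0 (X \<omega> - Z \<omega>) ^ n) \<partial>P) =
      (\<integral>\<^sup>+ \<omega>. (\<integral>\<^sup>+ r. ?w r * (\<integral>\<^sup>+ s. ?i \<omega> r s \<partial>lborel) \<partial>lborel) \<partial>P)"
    unfolding positive_part_power_layer_cake[OF n]
    by (intro nn_integral_cong arg_cong2[where f = "(*)"]) (auto split: split_indicator)
  also have "\<dots> = (\<integral>\<^sup>+ r. (\<integral>\<^sup>+ \<omega>. ?w r * (\<integral>\<^sup>+ s. ?i \<omega> r s \<partial>lborel) \<partial>P) \<partial>lborel)"
    by (rule Fubini'[symmetric]) measurable
  also have "\<dots> = (\<integral>\<^sup>+ r. ?w r * (\<integral>\<^sup>+ \<omega>. (\<integral>\<^sup>+ s. ?i \<omega> r s \<partial>lborel) \<partial>P) \<partial>lborel)"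
    by (intro nn_integral_cong nn_integral_cmult) measurable
  also have "\<dots> = (\<integral>\<^sup>+ r. ?w r * (\<integral>\<^sup>+ s. (\<integral>\<^sup>+ \<omega>. ?i \<omega> r s \<partial>P) \<partial>lborel) \<partial>lborel)"
    by (intro nn_integral_cong arg_cong2[where f = "(*)"] Fubini'[symmetric] refl) measurable
  also have "\<dots> = (\<integral>\<^sup>+ r. ?w r *
       (\<integral>\<^sup>+ s. emeasure P {\<omega> \<in> space P. Z \<omega> \<le> s \<and> s + r < X \<omega>} \<partial>lborel) \<partial>lborel)"
    by (intro nn_integral_cong arg_cong2[where f = "(*)"] nn_integral_indicator refl) measurable
  finally show ?thesis .
qed

text \<open>
  For given marginals, \<open>P (Z \<le> s, s + r < X)\<close> is at least \<open>P (Z \<le> s) - P (X \<le> s + r)\<close>, and the monotone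
  coupling attains the positive part of this bound for all \<open>s\<close> and \<open>r\<close> at once.
\<close>
lemma quantile_coupling_positive_part_optimal:
  fixes X Z :: "'a \<Rightarrow> real"
  assumes P: "prob_space P" and XZ [measurable]: "X \<in> borel_measurable P" "Z \<in> borel_measurable P"
    and n: "2 \<le> n"
  shows "(\<integral>\<^sup>+ u. ennreal (max 0 (quantile (distr P borel X) u - quantile (distr P borel Z) u) ^ n)
      \<partial>unit_interval) \<le> (\<integral>\<^sup>+ \<omega>. ennreal (max 0 (X \<omega> - Z \<omega>) ^ n) \<partial>P)"
proof -
  interpret prob_space P by fact
  have MX: "real_distribution (distr P borel X)" and MZ: "real_distribution (distr P borel Z)"
    by (auto intro: real_distribution_distr)
  have "emeasure unit_interval {u \<in> space unit_interval. quantile (distr P borel Z) u \<le> s \<and>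
          s + r < quantile (distr P borel X) u}
      \<le> emeasure P {\<omega> \<in> space P. Z \<omega> \<le> s \<and> s + r < X \<omega>}" for s r
  proof -
    have "cdf (distr P borel Z) s = prob {\<omega> \<in> space P. Z \<omega> \<le> s}"
      "cdf (distr P borel X) (s + r) = prob {\<omega> \<in> space P. X \<omega> \<le> s + r}"
      unfolding cdf_def by (auto simp: measure_distr intro!: arg_cong[where f = prob])
    moreover have "prob {\<omega> \<in> space P. Z \<omega> \<le> s}
        \<le> prob ({\<omega> \<in> space P. Z \<omega> \<le> s \<and> s + r < X \<omega>} \<union> {\<omega> \<in> space P. X \<omega> \<le> s + r})"
      by (intro finite_measure_mono) auto
    moreover have "\<dots> \<le> prob {\<omega> \<in> space P. Z \<omega> \<le> s \<and> s + r < X \<omega>} + prob {\<omega> \<in> space P. X \<omega> \<le> s + r}"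
      by (intro measure_Un_le) auto
    ultimately show ?thesis
      unfolding emeasure_quantile_between[OF MZ MX] emeasure_eq_measure
      by (intro ennreal_leI) linarith
  qed
  then show ?thesis
    unfolding nn_integral_positive_part_power[OF P XZ n]
      nn_integral_positive_part_power[OF prob_space_unit_interval measurable_quantile[OF MX]
        measurable_quantile[OF MZ] n]
    by (intro nn_integral_mono mult_left_mono) auto
qed

lemma abs_power_eq_positive_parts:
  fixes a :: real
  assumes "0 < n"
  shows "\<bar>a\<bar> ^ n = max 0 a ^ n + max 0 (- a) ^ n"
  using assms by (cases "0 \<le> a") auto

text \<open>
  The two signs of \<open>X - Z\<close> contribute separately, and the one-sided estimate applies to each of them.
\<close>
lemma quantile_coupling_optimal:
  fixes X Z :: "'a \<Rightarrow> real"
  assumes P: "prob_space P" and XZ [measurable]: "X \<in> borel_measurable P" "Z \<in> borel_measurable P"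
    and n: "2 \<le> n"
  shows "(\<integral>\<^sup>+ u. ennreal (\<bar>quantile (distr P borel X) u - quantile (distr P borel Z) u\<bar> ^ n)
      \<partial>unit_interval) \<le> (\<integral>\<^sup>+ \<omega>. ennreal (\<bar>X \<omega> - Z \<omega>\<bar> ^ n) \<partial>P)"
proof -
  interpret prob_space P by fact
  have [measurable]: "quantile (distr P borel X) \<in> borel_measurable unit_interval"
    "quantile (distr P borel Z) \<in> borel_measurable unit_interval"
    by (auto intro!: measurable_quantile real_distribution_distr)
  have split: "ennreal (\<bar>a - b\<bar> ^ n) = ennreal (max 0 (a - b) ^ n) + ennreal (max 0 (b - a) ^ n)"
    for a b :: real
    using n by (subst abs_power_eq_positive_parts) auto
  show ?thesis
    unfolding split
    using quantile_coupling_positive_part_optimal[OF P XZ(1,2) n]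
      quantile_coupling_positive_part_optimal[OF P XZ(2,1) n]
    by (subst (1 2) nn_integral_add) (auto intro: add_mono)
qed

section \<open>Quantile distance and weighted distance of densities\<close>

lemma power_add_superadditive:
  fixes a b :: real
  assumes "0 \<le> a" "0 \<le> b" "0 < n"
  shows "a ^ n + b ^ n \<le> (a + b) ^ n"
  using assms(3)
proof (induction n rule: nat_induct_non_zero)
  case (Suc n)
  have "a ^ Suc n + b ^ Suc n \<le> (a + b) * (a ^ n + b ^ n)"
    using assms by (simp add: algebra_simps)
  also have "\<dots> \<le> (a + b) * (a + b) ^ n"
    using Suc assms by (intro mult_left_mono) auto
  finally show ?case by simp
qed simp

lemma nn_integral_abs_power_nonneg:
  fixes a b :: real
  assumes "0 \<le> a" "a \<le> b"
  shows "(\<integral>\<^sup>+ x. ennreal (real n * \<bar>x\<bar> ^ (n - 1)) * indicator {a..b} x \<partial>lborel) = ennreal (b ^ n - a ^ n)"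
proof (rule nn_integral_FTC_Icc[where F = "\<lambda>x. x ^ n" and f = "\<lambda>x. real n * \<bar>x\<bar> ^ (n - 1)"])
  fix x assume "x \<in> {a..b}"
  then have "\<bar>x\<bar> = x" using assms by auto
  then show "((\<lambda>x. x ^ n) has_real_derivative real n * \<bar>x\<bar> ^ (n - 1)) (at x)"
    by (auto intro!: derivative_eq_intros)
qed (use assms in auto)

lemma nn_integral_abs_power_nonpos:
  fixes a b :: real
  assumes "a \<le> b" "b \<le> 0"
  shows "(\<integral>\<^sup>+ x. ennreal (real n * \<bar>x\<bar> ^ (n - 1)) * indicator {a..b} x \<partial>lborel)
    = ennreal ((- a) ^ n - (- b) ^ n)"
proof -
  have "(\<integral>\<^sup>+ x. ennreal (real n * \<bar>x\<bar> ^ (n - 1)) * indicator {a..b} x \<partial>lborel)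
     = ennreal (- ((- b) ^ n) - - ((- a) ^ n))"
  proof (rule nn_integral_FTC_Icc[where F = "\<lambda>x. - ((- x) ^ n)" and f = "\<lambda>x. real n * \<bar>x\<bar> ^ (n - 1)"])
    fix x assume "x \<in> {a..b}"
    then have "\<bar>x\<bar> = - x" using assms by auto
    then show "((\<lambda>x. - ((- x) ^ n)) has_real_derivative real n * \<bar>x\<bar> ^ (n - 1)) (at x)"
      by (auto intro!: derivative_eq_intros)
  qed (use assms in auto)
  then show ?thesis by simp
qed

text \<open>
  The half of the interval that is farther from the origin does not contain it in its interior. Shifting
  this half to the origin only lowers its weight, which then is \<open>((b - a) / 2)^n\<close>.
\<close>
lemma gap_power_le_layer:
  fixes a b :: real
  assumes n: "0 < n" and ab: "a < b"
  shows "ennreal ((b - a) ^ n) \<le>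
    2 ^ n * (\<integral>\<^sup>+ x. ennreal (real n * \<bar>x\<bar> ^ (n - 1)) * indicator {a..<b} x \<partial>lborel)" (is "_ \<le> _ * ?I")
proof -
  define h where "h = (b - a) / 2"
  have h: "0 < h" "b - a = 2 * h" using ab by (auto simp: h_def)
  have "ennreal (h ^ n) \<le> ?I"
  proof (cases "h \<le> b")
    case True
    have "h ^ n \<le> b ^ n - (b - h) ^ n"
      using power_add_superadditive[of h "b - h" n] True h n by simp
    then have "ennreal (h ^ n) \<le> ennreal (b ^ n - (b - h) ^ n)"
      by (rule ennreal_leI)
    also have "\<dots> = (\<integral>\<^sup>+ x. ennreal (real n * \<bar>x\<bar> ^ (n - 1)) * indicator {b - h..b} x \<partial>lborel)"
      using True h by (subst nn_integral_abs_power_nonneg) auto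
    also have "\<dots> \<le> ?I"
      by (rule nn_integral_mono_AE, rule AE_mp[OF AE_lborel_singleton[of b]])
        (use h in \<open>auto split: split_indicator\<close>)
    finally show ?thesis .
  next
    case False
    have "h ^ n \<le> (- a) ^ n - (- (a + h)) ^ n"
      using power_add_superadditive[of h "- (a + h)" n] False h n by simp
    then have "ennreal (h ^ n) \<le> ennreal ((- a) ^ n - (- (a + h)) ^ n)"
      by (rule ennreal_leI)
    also have "\<dots> = (\<integral>\<^sup>+ x. ennreal (real n * \<bar>x\<bar> ^ (n - 1)) * indicator {a..a + h} x \<partial>lborel)"
      using False h by (subst nn_integral_abs_power_nonpos) auto
    also have "\<dots> \<le> ?I"
      by (rule nn_integral_mono) (use h in \<open>auto split: split_indicator\<close>)
    finally show ?thesis .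
  qed
  then have "2 ^ n * ennreal (h ^ n) \<le> 2 ^ n * ?I"
    by (rule mult_left_mono) simp
  moreover have "2 ^ n * ennreal (h ^ n) = ennreal ((b - a) ^ n)"
    using h by (simp add: power_mult_distrib ennreal_mult ennreal_power[symmetric])
  ultimately show ?thesis by simp
qed

text \<open>
  A threshold \<open>x\<close> separates the two quantiles with probability \<open>\<bar>cdf M x - cdf N x\<bar>\<close>; the cost of a pair
  of quantiles is dominated by the weight of the thresholds separating them.
\<close>
lemma quantile_distance_le_cdf_distance:
  assumes M: "real_distribution M" and N: "real_distribution N" and n: "0 < n"
  shows "(\<integral>\<^sup>+ u. ennreal (\<bar>quantile M u - quantile N u\<bar> ^ n) \<partial>unit_interval)
    \<le> 2 ^ n * (\<integral>\<^sup>+ x. ennreal (real n * \<bar>x\<bar> ^ (n - 1)) * ennreal \<bar>cdf M x - cdf N x\<bar> \<partial>lborel)"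
proof -
  interpret prob_space unit_interval by (rule prob_space_unit_interval)
  interpret pair_sigma_finite unit_interval lborel ..
  note [measurable] = measurable_quantile[OF M] measurable_quantile[OF N]
  let ?w = "\<lambda>x::real. ennreal (real n * \<bar>x\<bar> ^ (n - 1))"
  let ?A = "\<lambda>x. {u \<in> space unit_interval. quantile M u \<le> x \<and> x < quantile N u}"
  let ?B = "\<lambda>x. {u \<in> space unit_interval. quantile N u \<le> x \<and> x < quantile M u}"
  have "(\<integral>\<^sup>+ u. ennreal (\<bar>quantile M u - quantile N u\<bar> ^ n) \<partial>unit_interval)
      \<le> (\<integral>\<^sup>+ u. 2 ^ n * (\<integral>\<^sup>+ x. ?w x * (indicator (?A x) u + indicator (?B x) u) \<partial>lborel) \<partial>unit_interval)"
  proof (intro nn_integral_mono)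
    fix u assume u: "u \<in> space unit_interval"
    let ?a = "quantile M u" and ?b = "quantile N u"
    consider "?a < ?b" | "?b < ?a" | "?a = ?b" by linarith
    then show "ennreal (\<bar>?a - ?b\<bar> ^ n)
        \<le> 2 ^ n * (\<integral>\<^sup>+ x. ?w x * (indicator (?A x) u + indicator (?B x) u) \<partial>lborel)"
    proof cases
      case 1
      have "(\<integral>\<^sup>+ x. ?w x * indicator {?a..<?b} x \<partial>lborel)
          = (\<integral>\<^sup>+ x. ?w x * (indicator (?A x) u + indicator (?B x) u) \<partial>lborel)"
        using 1 u by (intro nn_integral_cong) (auto split: split_indicator)
      then show ?thesis using gap_power_le_layer[OF n 1] 1 by simp
    next
      case 2
      have "(\<integral>\<^sup>+ x. ?w x * indicator {?b..<?a} x \<partial>lborel)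
          = (\<integral>\<^sup>+ x. ?w x * (indicator (?A x) u + indicator (?B x) u) \<partial>lborel)"
        using 2 u by (intro nn_integral_cong) (auto split: split_indicator)
      then show ?thesis using gap_power_le_layer[OF n 2] 2 by simp
    next
      case 3
      then show ?thesis using n by simp
    qed
  qed
  also have "\<dots> = 2 ^ n * (\<integral>\<^sup>+ u. (\<integral>\<^sup>+ x. ?w x * (indicator (?A x) u + indicator (?B x) u) \<partial>lborel) \<partial>unit_interval)"
    by (rule nn_integral_cmult) measurable
  also have "(\<integral>\<^sup>+ u. (\<integral>\<^sup>+ x. ?w x * (indicator (?A x) u + indicator (?B x) u) \<partial>lborel) \<partial>unit_interval)
      = (\<integral>\<^sup>+ x. (\<integral>\<^sup>+ u. ?w x * (indicator (?A x) u + indicator (?B x) u) \<partial>unit_interval) \<partial>lborel)"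
    by (rule Fubini'[symmetric]) measurable
  also have "\<dots> = (\<integral>\<^sup>+ x. ?w x * (emeasure unit_interval (?A x) + emeasure unit_interval (?B x)) \<partial>lborel)"
  proof (intro nn_integral_cong)
    fix x :: real
    have "(\<integral>\<^sup>+ u. ?w x * (indicator (?A x) u + indicator (?B x) u) \<partial>unit_interval)
        = ?w x * (\<integral>\<^sup>+ u. indicator (?A x) u + indicator (?B x) u \<partial>unit_interval)"
      by (rule nn_integral_cmult) measurable
    also have "(\<integral>\<^sup>+ u. indicator (?A x) u + indicator (?B x) u \<partial>unit_interval)
        = (\<integral>\<^sup>+ u. indicator (?A x) u \<partial>unit_interval) + (\<integral>\<^sup>+ u. indicator (?B x) u \<partial>unit_interval)"
      by (rule nn_integral_add) measurable
    also have "\<dots> = emeasure unit_interval (?A x) + emeasure unit_interval (?B x)"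
      by (intro arg_cong2[where f = "(+)"] nn_integral_indicator) measurable
    finally show "(\<integral>\<^sup>+ u. ?w x * (indicator (?A x) u + indicator (?B x) u) \<partial>unit_interval)
        = ?w x * (emeasure unit_interval (?A x) + emeasure unit_interval (?B x))" .
  qed
  also have "\<dots> = (\<integral>\<^sup>+ x. ?w x * ennreal \<bar>cdf M x - cdf N x\<bar> \<partial>lborel)"
  proof (intro nn_integral_cong arg_cong2[where f = "(*)"] refl)
    fix x :: real
    show "emeasure unit_interval (?A x) + emeasure unit_interval (?B x) = ennreal \<bar>cdf M x - cdf N x\<bar>"
      unfolding emeasure_quantile_between[OF M N] emeasure_quantile_between[OF N M]
      by (cases "cdf N x \<le> cdf M x") (simp_all add: ennreal_neg)
  qed
  finally show ?thesis .
qed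

lemma measure_density_diff_le:
  fixes f g :: "real \<Rightarrow> real"
  assumes [measurable]: "f \<in> borel_measurable borel" "g \<in> borel_measurable borel" "A \<in> sets borel"
    and g: "\<And>x. 0 \<le> g x"
    and M: "finite_measure (density lborel (\<lambda>x. ennreal (f x)))"
    and N: "finite_measure (density lborel (\<lambda>x. ennreal (g x)))"
  shows "ennreal (measure (density lborel (\<lambda>x. ennreal (f x))) A - measure (density lborel (\<lambda>x. ennreal (g x))) A)
     \<le> (\<integral>\<^sup>+ x. ennreal \<bar>f x - g x\<bar> * indicator A x \<partial>lborel)"
proof -
  interpret M: finite_measure "density lborel (\<lambda>x. ennreal (f x))" by fact
  interpret N: finite_measure "density lborel (\<lambda>x. ennreal (g x))" by fact
  have "emeasure (density lborel (\<lambda>x. ennreal (f x))) A = (\<integral>\<^sup>+ x. ennreal (f x) * indicator A x \<partial>lborel)"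
    by (rule emeasure_density) measurable
  also have "\<dots> \<le> (\<integral>\<^sup>+ x. ennreal (g x) * indicator A x + ennreal \<bar>f x - g x\<bar> * indicator A x \<partial>lborel)"
    using g by (intro nn_integral_mono)
      (auto split: split_indicator simp: ennreal_plus[symmetric] simp del: ennreal_plus intro!: ennreal_leI)
  also have "\<dots> = (\<integral>\<^sup>+ x. ennreal (g x) * indicator A x \<partial>lborel) + (\<integral>\<^sup>+ x. ennreal \<bar>f x - g x\<bar> * indicator A x \<partial>lborel)"
    by (rule nn_integral_add) measurable
  also have "(\<integral>\<^sup>+ x. ennreal (g x) * indicator A x \<partial>lborel) = emeasure (density lborel (\<lambda>x. ennreal (g x))) A"
    by (rule emeasure_density[symmetric]) measurable
  finally have *: "ennreal (measure (density lborel (\<lambda>x. ennreal (f x))) A)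
      \<le> ennreal (measure (density lborel (\<lambda>x. ennreal (g x))) A) + (\<integral>\<^sup>+ x. ennreal \<bar>f x - g x\<bar> * indicator A x \<partial>lborel)"
    by (simp add: M.emeasure_eq_measure N.emeasure_eq_measure)
  show ?thesis
  proof (cases "(\<integral>\<^sup>+ x. ennreal \<bar>f x - g x\<bar> * indicator A x \<partial>lborel)")
    case (real r)
    with * have "ennreal (measure (density lborel (\<lambda>x. ennreal (f x))) A)
      \<le> ennreal (measure (density lborel (\<lambda>x. ennreal (g x))) A + r)"
      by simp
    then have "measure (density lborel (\<lambda>x. ennreal (f x))) A
      \<le> measure (density lborel (\<lambda>x. ennreal (g x))) A + r"
      using real by (subst (asm) ennreal_le_iff) auto
    then show ?thesis
      unfolding real(2) by (intro ennreal_leI) simp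
  qed simp
qed

text \<open>
  The distribution functions are compared through the tail that does not contain the origin. This is what
  makes the weight \<open>n \<bar>x\<bar>^(n-1)\<close> integrate to \<open>\<bar>y\<bar>^n\<close> in the next lemma.
\<close>
lemma abs_cdf_diff_le_tail:
  fixes f g :: "real \<Rightarrow> real"
  assumes [measurable]: "f \<in> borel_measurable borel" "g \<in> borel_measurable borel"
    and f: "\<And>x. 0 \<le> f x" and g: "\<And>x. 0 \<le> g x"
    and M: "prob_space (density lborel (\<lambda>x. ennreal (f x)))"
    and N: "prob_space (density lborel (\<lambda>x. ennreal (g x)))"
  shows "ennreal \<bar>cdf (density lborel (\<lambda>x. ennreal (f x))) x - cdf (density lborel (\<lambda>x. ennreal (g x))) x\<bar>
     \<le> (\<integral>\<^sup>+ y. ennreal \<bar>f y - g y\<bar> * (indicator {y. 0 \<le> x \<and> x < y \<or> x < 0 \<and> y \<le> x} y) \<partial>lborel)"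
    (is "ennreal \<bar>cdf ?M x - cdf ?N x\<bar> \<le> _")
proof -
  interpret M: prob_space ?M by fact
  interpret N: prob_space ?N by fact
  let ?A = "{y. 0 \<le> x \<and> x < y \<or> x < 0 \<and> y \<le> x}"
  have A: "?A = (if 0 \<le> x then UNIV - {..x} else {..x})" by auto
  have [measurable]: "?A \<in> sets borel" unfolding A by auto
  have "\<bar>cdf ?M x - cdf ?N x\<bar> = \<bar>measure ?M ?A - measure ?N ?A\<bar>"
    using M.prob_compl[of "{..x}"] N.prob_compl[of "{..x}"] by (simp add: A cdf_def abs_minus_commute)
  moreover have "ennreal (measure ?M ?A - measure ?N ?A) \<le> (\<integral>\<^sup>+ y. ennreal \<bar>f y - g y\<bar> * indicator ?A y \<partial>lborel)"
    by (intro measure_density_diff_le g M.finite_measure_axioms N.finite_measure_axioms) measurable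
  moreover have "ennreal (measure ?N ?A - measure ?M ?A) \<le> (\<integral>\<^sup>+ y. ennreal \<bar>g y - f y\<bar> * indicator ?A y \<partial>lborel)"
    by (intro measure_density_diff_le f M.finite_measure_axioms N.finite_measure_axioms) measurable
  ultimately show ?thesis
    by (cases "measure ?N ?A \<le> measure ?M ?A") (simp_all only: abs_minus_commute[of "g _"] abs_of_nonneg
      abs_of_nonpos diff_ge_0_iff_ge diff_le_0_iff_le linorder_not_le less_imp_le minus_diff_eq)
qed

lemma quantile_distance_le_weighted_density_distance:
  fixes f g :: "real \<Rightarrow> real"
  assumes [measurable]: "f \<in> borel_measurable borel" "g \<in> borel_measurable borel"
    and f: "\<And>x. 0 \<le> f x" and g: "\<And>x. 0 \<le> g x"
    and M: "prob_space (density lborel (\<lambda>x. ennreal (f x)))"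
    and N: "prob_space (density lborel (\<lambda>x. ennreal (g x)))"
    and n: "0 < n"
  shows "(\<integral>\<^sup>+ u. ennreal (\<bar>quantile (density lborel (\<lambda>x. ennreal (f x))) u
        - quantile (density lborel (\<lambda>x. ennreal (g x))) u\<bar> ^ n) \<partial>unit_interval)
    \<le> 2 ^ n * (\<integral>\<^sup>+ y. ennreal (\<bar>y\<bar> ^ n * \<bar>f y - g y\<bar>) \<partial>lborel)"
    (is "(\<integral>\<^sup>+ u. ennreal (\<bar>quantile ?M u - quantile ?N u\<bar> ^ n) \<partial>_) \<le> _")
proof -
  have RM: "real_distribution ?M" and RN: "real_distribution ?N"
    using M N by (auto simp: real_distribution_def real_distribution_axioms_def)
  let ?w = "\<lambda>x::real. ennreal (real n * \<bar>x\<bar> ^ (n - 1))"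
  let ?i = "\<lambda>x y::real. indicator {y. 0 \<le> x \<and> x < y \<or> x < 0 \<and> y \<le> x} y :: ennreal"
  have [measurable]: "(\<lambda>(x, y). ?i x y) \<in> borel_measurable (borel \<Otimes>\<^sub>M borel)"
    by (simp add: indicator_def)
  have "(\<integral>\<^sup>+ x. ?w x * ennreal \<bar>cdf ?M x - cdf ?N x\<bar> \<partial>lborel)
      \<le> (\<integral>\<^sup>+ x. ?w x * (\<integral>\<^sup>+ y. ennreal \<bar>f y - g y\<bar> * ?i x y \<partial>lborel) \<partial>lborel)"
    by (intro nn_integral_mono mult_left_mono abs_cdf_diff_le_tail f g M N) auto
  also have "\<dots> = (\<integral>\<^sup>+ x. (\<integral>\<^sup>+ y. ?w x * (ennreal \<bar>f y - g y\<bar> * ?i x y) \<partial>lborel) \<partial>lborel)"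
    by (intro nn_integral_cong nn_integral_cmult[symmetric]) measurable
  also have "\<dots> = (\<integral>\<^sup>+ y. (\<integral>\<^sup>+ x. ?w x * (ennreal \<bar>f y - g y\<bar> * ?i x y) \<partial>lborel) \<partial>lborel)"
    by (rule lborel_pair.Fubini') measurable
  also have "\<dots> \<le> (\<integral>\<^sup>+ y. ennreal (\<bar>y\<bar> ^ n * \<bar>f y - g y\<bar>) \<partial>lborel)"
  proof (intro nn_integral_mono)
    fix y :: real
    have inner: "(\<integral>\<^sup>+ x. ?w x * ?i x y \<partial>lborel) \<le> ennreal (\<bar>y\<bar> ^ n)"
    proof (cases "0 \<le> y")
      case True
      have "(\<integral>\<^sup>+ x. ?w x * ?i x y \<partial>lborel) \<le> (\<integral>\<^sup>+ x. ?w x * indicator {0..y} x \<partial>lborel)"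
        using True by (intro nn_integral_mono) (auto split: split_indicator)
      then show ?thesis
        using True n by (subst (asm) nn_integral_abs_power_nonneg) (auto simp: zero_power)
    next
      case False
      have "(\<integral>\<^sup>+ x. ?w x * ?i x y \<partial>lborel) \<le> (\<integral>\<^sup>+ x. ?w x * indicator {y..0} x \<partial>lborel)"
        using False by (intro nn_integral_mono) (auto split: split_indicator)
      then show ?thesis
        using False n by (subst (asm) nn_integral_abs_power_nonpos) (auto simp: zero_power)
    qed
    have "(\<integral>\<^sup>+ x. ?w x * (ennreal \<bar>f y - g y\<bar> * ?i x y) \<partial>lborel)
       = (\<integral>\<^sup>+ x. ennreal \<bar>f y - g y\<bar> * (?w x * ?i x y) \<partial>lborel)"
      by (simp add: ac_simps)
    also have "\<dots> = ennreal \<bar>f y - g y\<bar> * (\<integral>\<^sup>+ x. ?w x * ?i x y \<partial>lborel)"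
      by (rule nn_integral_cmult) measurable
    also have "\<dots> \<le> ennreal \<bar>f y - g y\<bar> * ennreal (\<bar>y\<bar> ^ n)"
      by (intro mult_left_mono inner) simp
    finally show "(\<integral>\<^sup>+ x. ?w x * (ennreal \<bar>f y - g y\<bar> * ?i x y) \<partial>lborel) \<le> ennreal (\<bar>y\<bar> ^ n * \<bar>f y - g y\<bar>)"
      by (simp add: ennreal_mult mult.commute)
  qed
  finally have "2 ^ n * (\<integral>\<^sup>+ x. ?w x * ennreal \<bar>cdf ?M x - cdf ?N x\<bar> \<partial>lborel)
      \<le> 2 ^ n * (\<integral>\<^sup>+ y. ennreal (\<bar>y\<bar> ^ n * \<bar>f y - g y\<bar>) \<partial>lborel)"
    by (rule mult_left_mono) simp
  with quantile_distance_le_cdf_distance[OF RM RN n] show ?thesis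
    by (rule order_trans)
qed

section \<open>Taylor coefficients of powers of the sinc function\<close>

definition csinc :: "complex \<Rightarrow> complex" where
  "csinc z = (if z = 0 then 1 else sin z / z)"

text \<open>
  An even power is a Jackson-type kernel: nonnegative, of exponential type \<open>q\<close> as an entire function, and
  decaying like \<open>\<bar>u\<bar>^(-q)\<close> on the real line.
\<close>
definition sinc_power :: "nat \<Rightarrow> real \<Rightarrow> real" where
  "sinc_power q u = sinc u ^ q"

lemma csinc_of_real_power: "csinc (of_real u) ^ q = of_real (sinc_power q u)"
  by (simp add: csinc_def sinc_power_def sin_of_real)

text \<open>
  The singularity at the origin is a removable one: the function is the difference quotient of the sine.
\<close>
lemma holomorphic_csinc: "csinc holomorphic_on UNIV"
proof -
  have "(\<lambda>z. if z = 0 then deriv sin 0 else (sin z - sin 0) / (z - 0)) holomorphic_on (UNIV :: complex set)"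
    by (rule pole_lemma) (auto intro!: holomorphic_intros)
  moreover have "deriv sin 0 = (1 :: complex)"
    by (rule DERIV_imp_deriv) (auto intro!: derivative_eq_intros)
  ultimately show ?thesis
    by (simp add: csinc_def[abs_def] cong: if_cong)
qed

lemma norm_exp_i_le: "norm (exp (\<i> * z)) \<le> exp \<bar>Im z\<bar>" "norm (exp (- (\<i> * z))) \<le> exp \<bar>Im z\<bar>"
  by (auto simp: norm_exp_eq_Re)

lemma norm_sin_le_exp_abs_Im: "norm (sin z) \<le> exp \<bar>Im z\<bar>" for z :: complex
proof -
  have "norm (exp (\<i> * z) - exp (- (\<i> * z))) \<le> exp \<bar>Im z\<bar> + exp \<bar>Im z\<bar>"
    by (intro norm_triangle_le_diff add_mono norm_exp_i_le)
  then show ?thesis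
    by (simp add: sin_exp_eq norm_divide norm_mult)
qed

lemma norm_cos_le_exp_abs_Im: "norm (cos z) \<le> exp \<bar>Im z\<bar>" for z :: complex
proof -
  have "norm (exp (\<i> * z) + exp (- (\<i> * z))) \<le> exp \<bar>Im z\<bar> + exp \<bar>Im z\<bar>"
    by (intro norm_triangle_le add_mono norm_exp_i_le)
  then show ?thesis
    by (simp add: cos_exp_eq norm_divide norm_mult)
qed

text \<open>
  The mean value inequality for the sine on the segment from \<open>0\<close> to \<open>z\<close>, on which the cosine is bounded by
  \<open>exp \<bar>Im z\<bar>\<close>. The bound has constant \<open>1\<close>, which survives taking \<open>q\<close>-th powers.
\<close>
lemma norm_csinc_le: "norm (csinc z) \<le> exp \<bar>Im z\<bar>"
proof (cases "z = 0")
  case False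
  have "norm (sin z - sin 0) \<le> exp \<bar>Im z\<bar> * norm (z - 0)"
  proof (rule field_differentiable_bound[where S = "closed_segment 0 z" and f' = cos])
    fix w assume "w \<in> closed_segment 0 z"
    then obtain t where t: "0 \<le> t" "t \<le> 1" "w = of_real t * z"
      by (auto simp: closed_segment_def scaleR_conv_of_real)
    then have "\<bar>Im w\<bar> \<le> \<bar>Im z\<bar>"
      by (simp add: abs_mult mult_left_le_one_le)
    then show "norm (cos w) \<le> exp \<bar>Im z\<bar>"
      using norm_cos_le_exp_abs_Im[of w] by (meson exp_le_cancel_iff order_trans)
  qed (auto intro!: derivative_eq_intros)
  then show ?thesis
    using False by (simp add: csinc_def norm_divide divide_le_eq)
qed (simp add: csinc_def)

lemma norm_csinc_le_divide: "z \<noteq> 0 \<Longrightarrow> norm (csinc z) \<le> exp \<bar>Im z\<bar> / norm z"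
  using norm_sin_le_exp_abs_Im[of z] by (simp add: csinc_def norm_divide divide_right_mono)

lemma abs_sinc_power_le:
  "\<bar>sinc_power q u\<bar> \<le> 1" "u \<noteq> 0 \<Longrightarrow> \<bar>sinc_power q u\<bar> \<le> (1 / \<bar>u\<bar>) ^ q"
proof -
  have norm: "\<bar>sinc_power q u\<bar> = norm (csinc (of_real u)) ^ q"
    by (metis csinc_of_real_power norm_of_real norm_power real_norm_def)
  show "\<bar>sinc_power q u\<bar> \<le> 1"
    unfolding norm using norm_csinc_le[of "of_real u"] by (intro power_le_one) auto
  show "\<bar>sinc_power q u\<bar> \<le> (1 / \<bar>u\<bar>) ^ q" if "u \<noteq> 0"
    unfolding norm using norm_csinc_le_divide[of "of_real u"] that by (intro power_mono) auto
qed

definition sinc_power_coeff :: "nat \<Rightarrow> real \<Rightarrow> nat \<Rightarrow> complex" where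
  "sinc_power_coeff q u l = (deriv ^^ l) (\<lambda>z. csinc z ^ q) (of_real u) / fact l"

lemma holomorphic_csinc_power: "(\<lambda>z. csinc z ^ q) holomorphic_on A"
  using holomorphic_csinc holomorphic_on_subset by (intro holomorphic_intros) blast

lemma sinc_power_sums:
  "(\<lambda>l. Re (sinc_power_coeff q u l) * v ^ l) sums sinc_power q (u + v)"
proof -
  have "(\<lambda>l. (deriv ^^ l) (\<lambda>z. csinc z ^ q) (of_real u) / fact l * (of_real (u + v) - of_real u) ^ l)
      sums csinc (of_real (u + v)) ^ q"
    by (rule holomorphic_power_series[where r = "\<bar>v\<bar> + 1"])
      (auto simp: dist_norm intro!: holomorphic_csinc_power)
  then have "(\<lambda>l. sinc_power_coeff q u l * of_real (v ^ l)) sums of_real (sinc_power q (u + v))"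
    unfolding csinc_of_real_power sinc_power_coeff_def[symmetric] of_real_diff[symmetric] by simp
  then have "(\<lambda>l. Re (sinc_power_coeff q u l * of_real (v ^ l))) sums Re (of_real (sinc_power q (u + v)))"
    by (rule sums_Re)
  then show ?thesis by simp
qed

lemma norm_sinc_power_coeff_le_Cauchy:
  assumes R: "0 < R" and B: "\<And>z. norm (of_real u - z) = R \<Longrightarrow> norm (csinc z ^ q) \<le> B"
  shows "norm (sinc_power_coeff q u l) \<le> B / R ^ l"
proof -
  have "norm ((deriv ^^ l) (\<lambda>z. csinc z ^ q) (of_real u)) \<le> fact l * B / R ^ l"
    by (rule Cauchy_inequality)
      (use R B in \<open>auto intro!: holomorphic_csinc_power holomorphic_on_imp_continuous_on\<close>)
  then show ?thesis
    by (simp add: sinc_power_coeff_def norm_divide divide_le_eq mult.commute)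
qed

lemma exp_nat_ge_power_div:
  assumes "0 < q"
  shows "(real l / real q) ^ q \<le> exp (real l)"
proof -
  have "real l / real q \<le> exp (real l / real q)"
    using exp_ge_add_one_self[of "real l / real q"] by linarith
  then have "(real l / real q) ^ q \<le> exp (real l / real q) ^ q"
    by (intro power_mono) auto
  also have "\<dots> = exp (real l)"
    using assms by (simp add: exp_of_nat_mult[symmetric])
  finally show ?thesis .
qed

text \<open>
  The function has exponential type \<open>q\<close>; the radius \<open>l / q\<close> is the one that optimizes Cauchy's estimate.
\<close>
lemma norm_sinc_power_coeff_le:
  assumes q: "0 < q" and l: "0 < l"
  shows "norm (sinc_power_coeff q u l) \<le> (exp 1 * real q / real l) ^ l"
proof -
  have Im: "\<bar>Im z\<bar> \<le> real l / real q" if "norm (of_real u - z) = real l / real q" for z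
    using abs_Im_le_cmod[of "of_real u - z"] that by simp
  have "norm (csinc z ^ q) \<le> exp (real l)" if z: "norm (of_real u - z) = real l / real q" for z
  proof -
    have "norm (csinc z) ^ q \<le> exp (real l / real q) ^ q"
      using norm_csinc_le[of z] Im[OF z] by (intro power_mono) (auto intro: order_trans)
    then show ?thesis
      using q by (simp add: norm_power exp_of_nat_mult[symmetric])
  qed
  then have "norm (sinc_power_coeff q u l) \<le> exp (real l) / (real l / real q) ^ l"
    using q l by (intro norm_sinc_power_coeff_le_Cauchy) auto
  also have "\<dots> = (exp 1 * real q / real l) ^ l"
    by (simp add: power_divide power_mult_distrib exp_of_nat_mult[symmetric])
  finally show ?thesis .
qed

text \<open>
  The Taylor coefficients at a point \<open>u\<close> far from the origin inherit the decay \<open>\<bar>u\<bar>^(-q)\<close> of the function,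
  at the price of a second factor \<open>exp l\<close>. If the circle of radius \<open>l / q\<close> around \<open>u\<close> stays away from the
  origin, the decay holds on the whole circle. Otherwise \<open>\<bar>u\<bar>\<close> is less than \<open>2 l / q\<close>, and \<open>(\<bar>u\<bar> / 2)^q\<close> is
  absorbed by the extra factor.
\<close>
lemma norm_sinc_power_coeff_le_decay:
  assumes q: "0 < q" and l: "0 < l" and u: "u \<noteq> 0"
  shows "norm (sinc_power_coeff q u l) \<le> (exp 2 * real q / real l) ^ l * (2 / \<bar>u\<bar>) ^ q"
proof -
  have exp2: "(exp 2 * real q / real l) ^ l = exp (real l) * (exp 1 * real q / real l) ^ l"
  proof -
    have "exp 2 * real q / real l = exp 1 * (exp 1 * real q / real l)"
      by (simp add: exp_add[symmetric])
    then show ?thesis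
      by (simp only: power_mult_distrib[of "exp 1" "exp 1 * real q / real l"]) (simp add: exp_of_nat_mult[symmetric])
  qed
  show ?thesis
  proof (cases "real l / real q \<le> \<bar>u\<bar> / 2")
    case True
    have "norm (csinc z ^ q) \<le> exp (real l) * (2 / \<bar>u\<bar>) ^ q"
      if z: "norm (of_real u - z) = real l / real q" for z
    proof -
      have Im: "\<bar>Im z\<bar> \<le> real l / real q"
        using abs_Im_le_cmod[of "of_real u - z"] z by simp
      have nz: "\<bar>u\<bar> / 2 \<le> norm z"
        using norm_triangle_ineq2[of "of_real u" z] z True unfolding norm_of_real by linarith
      then have "norm (csinc z) \<le> exp \<bar>Im z\<bar> / norm z"
        using u by (intro norm_csinc_le_divide) auto
      also have "\<dots> \<le> exp (real l / real q) / (\<bar>u\<bar> / 2)"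
        using Im nz u by (intro frac_le) auto
      finally have "norm (csinc z) ^ q \<le> (exp (real l / real q) * (2 / \<bar>u\<bar>)) ^ q"
        by (intro power_mono) auto
      then show ?thesis
        using q by (simp add: norm_power power_mult_distrib power_divide exp_of_nat_mult[symmetric])
    qed
    then have "norm (sinc_power_coeff q u l) \<le> exp (real l) * (2 / \<bar>u\<bar>) ^ q / (real l / real q) ^ l"
      using q l by (intro norm_sinc_power_coeff_le_Cauchy) auto
    also have "\<dots> = (exp 1 * real q / real l) ^ l * (2 / \<bar>u\<bar>) ^ q"
      by (simp add: power_divide power_mult_distrib exp_of_nat_mult[symmetric] mult_ac)
    also have "\<dots> \<le> exp (real l) * (exp 1 * real q / real l) ^ l * (2 / \<bar>u\<bar>) ^ q"
      using mult_right_mono[of 1 "exp (real l)" "(exp 1 * real q / real l) ^ l"]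
      by (intro mult_right_mono) auto
    finally show ?thesis
      unfolding exp2 .
  next
    case False
    have "(\<bar>u\<bar> / 2) ^ q \<le> (real l / real q) ^ q"
      using False by (intro power_mono) auto
    also have "\<dots> \<le> exp (real l)"
      using q by (rule exp_nat_ge_power_div)
    finally have "1 \<le> exp (real l) * (2 / \<bar>u\<bar>) ^ q"
      using u by (simp add: power_divide field_simps)
    then have "(exp 1 * real q / real l) ^ l * 1
        \<le> (exp 1 * real q / real l) ^ l * (exp (real l) * (2 / \<bar>u\<bar>) ^ q)"
      by (intro mult_left_mono) auto
    then show ?thesis
      unfolding exp2 using norm_sinc_power_coeff_le[OF q l, of u] by (simp add: ac_simps)
  qed
qed

text \<open>
  This makes the total mass of the \<open>q\<close>-th power at least of order \<open>1 / q\<close>, which is all that the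
  normalization of the noise density needs.
\<close>
lemma sinc_power_ge_half:
  assumes q: "0 < q" and u: "\<bar>u\<bar> \<le> 1 / real q"
  shows "1 / 2 \<le> sinc_power q u"
proof -
  have u1: "\<bar>u\<bar> \<le> 1"
  proof -
    have "1 / real q \<le> 1" using q by simp
    with u show ?thesis by linarith
  qed
  have "1 - \<bar>u\<bar> / 2 \<le> sinc u"
  proof (cases "u = 0")
    case False
    have "\<bar>sin u - (\<Sum>m<3. sin_coeff m * u ^ m)\<bar> \<le> inverse (fact 3) * \<bar>u\<bar> ^ 3"
      by (rule Maclaurin_sin_bound)
    then have "\<bar>sin u - u\<bar> \<le> \<bar>u\<bar> ^ 3 / 6"
      by (simp add: sin_coeff_def eval_nat_numeral fact_numeral)
    then have "\<bar>sin u / u - 1\<bar> * \<bar>u\<bar> \<le> \<bar>u\<bar> ^ 2 / 6 * \<bar>u\<bar>"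
      using False by (simp add: abs_mult[symmetric] left_diff_distrib power3_eq_cube power2_eq_square)
    then have "\<bar>sin u / u - 1\<bar> \<le> \<bar>u\<bar> ^ 2 / 6"
      using False by (meson mult_le_cancel_right_pos zero_less_abs_iff)
    also have "\<dots> \<le> \<bar>u\<bar> / 2"
      using u1 mult_right_mono[OF u1, of "\<bar>u\<bar>"] by (simp add: power2_eq_square)
    finally show ?thesis
      using False by (simp, linarith)
  qed simp
  then have "(1 + (- \<bar>u\<bar> / 2)) ^ q \<le> sinc u ^ q"
    using u1 by (intro power_mono) auto
  moreover have "1 + real q * (- \<bar>u\<bar> / 2) \<le> (1 + (- \<bar>u\<bar> / 2)) ^ q"
    using u1 by (intro Bernoulli_inequality) auto
  moreover have "real q * \<bar>u\<bar> \<le> 1"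
    using u q by (simp add: field_simps)
  ultimately show ?thesis
    by (simp add: sinc_power_def)
qed

section \<open>Smoothing by a band-limited noise\<close>

text \<open>
  The common majorant of the noise density and of the differences of smoothed densities, up to
  normalization. It is \<open>min 1 ((a / \<bar>x\<bar>)^q)\<close>, with the value \<open>1\<close> at the origin.
\<close>
definition envelope :: "real \<Rightarrow> nat \<Rightarrow> real \<Rightarrow> real" where
  "envelope a q x = (if \<bar>x\<bar> \<le> a then 1 else (a / \<bar>x\<bar>) ^ q)"

lemma envelope_nonneg: "0 < a \<Longrightarrow> 0 \<le> envelope a q x"
  by (auto simp: envelope_def)

lemma measurable_envelope [measurable]: "envelope a q \<in> borel_measurable borel"
  unfolding envelope_def by measurable

lemma nn_integral_inverse_square_tail:
  fixes a :: real
  assumes "0 < a"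
  shows "(\<integral>\<^sup>+ y. ennreal (a ^ k / y ^ 2) * indicator {a..} y \<partial>lborel) = ennreal (a ^ k / a)"
proof -
  have "((\<lambda>y. - (a ^ k) / y) \<longlongrightarrow> 0) at_top"
    by real_asymp
  then have "(\<integral>\<^sup>+ y. ennreal (a ^ k / y ^ 2) * indicator {a..} y \<partial>lborel) = ennreal (0 - - (a ^ k) / a)"
  proof (rule nn_integral_FTC_atLeast[where F = "\<lambda>y. - (a ^ k) / y", rotated 3])
    fix y assume "a \<le> y"
    with assms have "y \<noteq> 0" by auto
    then show "((\<lambda>y. - (a ^ k) / y) has_real_derivative a ^ k / y ^ 2) (at y)"
      by (auto intro!: derivative_eq_intros simp: power2_eq_square)
  qed (use assms in auto)
  then show ?thesis by simp
qed

text \<open>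
  Beyond \<open>a\<close> the integrand is at most \<open>a^(n+2) / y^2\<close>; two more powers than the moment suffice for
  integrability.
\<close>
lemma nn_integral_power_envelope_le:
  fixes a :: real
  assumes a: "0 < a" and q: "n + 2 \<le> q"
  shows "(\<integral>\<^sup>+ y. ennreal (\<bar>y\<bar> ^ n * envelope a q y) \<partial>lborel) \<le> ennreal (4 * a ^ (n + 1))"
proof -
  let ?t = "\<lambda>y. ennreal (a ^ (n + 2) / y ^ 2) * indicator {a..} y"
  have pt: "ennreal (\<bar>y\<bar> ^ n * envelope a q y) \<le> ennreal (a ^ n) * indicator {- a..a} y + (?t y + ?t (- y))" for y
  proof (cases "\<bar>y\<bar> \<le> a")
    case True
    then have "ennreal (\<bar>y\<bar> ^ n * envelope a q y) \<le> ennreal (a ^ n) * indicator {- a..a} y"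
      by (auto simp: envelope_def abs_le_iff intro!: ennreal_leI power_mono split: split_indicator)
    also have "\<dots> \<le> \<dots> + (?t y + ?t (- y))" by simp
    finally show ?thesis .
  next
    case False
    have "(a / \<bar>y\<bar>) ^ q \<le> (a / \<bar>y\<bar>) ^ (n + 2)"
      using q a False by (intro power_decreasing) (auto simp: divide_le_eq_1)
    then have "\<bar>y\<bar> ^ n * (a / \<bar>y\<bar>) ^ q \<le> \<bar>y\<bar> ^ n * (a / \<bar>y\<bar>) ^ (n + 2)"
      by (intro mult_left_mono) auto
    also have "\<dots> = a ^ (n + 2) / y ^ 2"
      using False a by (simp add: power_add power_divide power2_eq_square abs_mult_self_eq)
    finally have *: "ennreal (\<bar>y\<bar> ^ n * envelope a q y) \<le> ennreal (a ^ (n + 2) / y ^ 2)"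
      using False by (intro ennreal_leI) (simp add: envelope_def)
    also have "\<dots> = ?t y + ?t (- y)"
      using False a by (cases "0 \<le> y") (auto split: split_indicator)
    also have "\<dots> \<le> ennreal (a ^ n) * indicator {- a..a} y + \<dots>" by simp
    finally show ?thesis .
  qed
  have tail: "(\<integral>\<^sup>+ y. ?t y \<partial>lborel) = ennreal (a ^ (n + 1))"
    using a by (subst nn_integral_inverse_square_tail) auto
  have tail': "(\<integral>\<^sup>+ y. ?t (- y) \<partial>lborel) = ennreal (a ^ (n + 1))"
    using nn_integral_real_affine[of ?t "-1" 0] tail by (simp del: power_Suc)
  have "(\<integral>\<^sup>+ y. ennreal (\<bar>y\<bar> ^ n * envelope a q y) \<partial>lborel)
      \<le> (\<integral>\<^sup>+ y. ennreal (a ^ n) * indicator {- a..a} y + (?t y + ?t (- y)) \<partial>lborel)"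
    by (intro nn_integral_mono pt)
  also have "\<dots> = (\<integral>\<^sup>+ y. ennreal (a ^ n) * indicator {- a..a} y \<partial>lborel) + ((\<integral>\<^sup>+ y. ?t y \<partial>lborel) + (\<integral>\<^sup>+ y. ?t (- y) \<partial>lborel))"
    by (simp add: nn_integral_add)
  also have "(\<integral>\<^sup>+ y. ennreal (a ^ n) * indicator {- a..a} y \<partial>lborel) = ennreal (2 * a ^ (n + 1))"
    using a by (simp add: nn_integral_cmult_indicator ennreal_mult[symmetric] algebra_simps)
  finally show ?thesis
    unfolding tail tail' using a by (simp add: ennreal_plus[symmetric] del: ennreal_plus power_Suc)
qed

lemma measurable_sinc_power [measurable]: "sinc_power q \<in> borel_measurable borel"
  unfolding sinc_power_def by measurable

lemma abs_sinc_power_le_envelope: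
  assumes "0 < w"
  shows "\<bar>sinc_power q (x / w)\<bar> \<le> envelope (2 * w) q x"
proof (cases "\<bar>x\<bar> \<le> 2 * w")
  case True
  then show ?thesis by (simp add: envelope_def abs_sinc_power_le)
next
  case False
  then have "\<bar>sinc_power q (x / w)\<bar> \<le> (1 / \<bar>x / w\<bar>) ^ q"
    using assms by (intro abs_sinc_power_le) auto
  also have "\<dots> \<le> (2 * w / \<bar>x\<bar>) ^ q"
    using assms by (intro power_mono) (auto simp: divide_right_mono)
  finally show ?thesis
    using False by (simp add: envelope_def)
qed

definition sinc_mass :: "nat \<Rightarrow> real \<Rightarrow> real" where
  "sinc_mass q w = (\<integral>x. sinc_power q (x / w) \<partial>lborel)"

definition sinc_density :: "nat \<Rightarrow> real \<Rightarrow> real \<Rightarrow> real" where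
  "sinc_density q w x = sinc_power q (x / w) / sinc_mass q w"

abbreviation sinc_noise :: "nat \<Rightarrow> real \<Rightarrow> real measure" where
  "sinc_noise q w \<equiv> density lborel (\<lambda>x. ennreal (sinc_density q w x))"

lemma integrable_sinc_power:
  assumes w: "0 < w" and q: "2 \<le> q"
  shows "integrable lborel (\<lambda>x. sinc_power q (x / w))"
proof (rule integrableI_bounded)
  have "(\<integral>\<^sup>+ x. ennreal (norm (sinc_power q (x / w))) \<partial>lborel)
      \<le> (\<integral>\<^sup>+ x. ennreal (\<bar>x\<bar> ^ 0 * envelope (2 * w) q x) \<partial>lborel)"
    using abs_sinc_power_le_envelope[OF w] by (intro nn_integral_mono ennreal_leI) simp
  also have "\<dots> \<le> ennreal (4 * (2 * w) ^ (0 + 1))"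
    using w q by (intro nn_integral_power_envelope_le) auto
  finally show "(\<integral>\<^sup>+ x. ennreal (norm (sinc_power q (x / w))) \<partial>lborel) < \<infinity>"
    by (simp add: le_less_trans)
qed measurable

lemma sinc_power_nonneg: "even q \<Longrightarrow> 0 \<le> sinc_power q u"
  unfolding sinc_power_def by (rule zero_le_even_power)

lemma sinc_mass_ge:
  assumes w: "0 < w" and q: "2 \<le> q" "even q"
  shows "w / real q \<le> sinc_mass q w"
proof -
  have "(\<integral>x. indicator {- (w / real q)..w / real q} x * (1 / 2) \<partial>lborel) \<le> sinc_mass q w"
    unfolding sinc_mass_def
  proof (rule integral_mono)
    fix x :: real
    show "indicator {- (w / real q)..w / real q} x * (1 / 2) \<le> sinc_power q (x / w)"
    proof (cases "\<bar>x\<bar> \<le> w / real q")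
      case True
      then have "\<bar>x / w\<bar> \<le> 1 / real q"
        using w by (simp add: field_simps)
      then show ?thesis
        using sinc_power_ge_half[of q "x / w"] q by (simp split: split_indicator)
    next
      case False
      then have "x \<notin> {- (w / real q)..w / real q}" by (auto simp: abs_le_iff)
      then show ?thesis using sinc_power_nonneg[OF q(2)] by simp
    qed
    show "integrable lborel (\<lambda>x. indicator {- (w / real q)..w / real q} x * (1 / 2) :: real)"
      by (intro integrable_mult_left integrable_real_indicator) (auto simp: emeasure_lborel_Icc_eq)
  qed (rule integrable_sinc_power[OF w q(1)])
  then show ?thesis using w by simp
qed

lemma sinc_mass_pos: "0 < w \<Longrightarrow> 2 \<le> q \<Longrightarrow> even q \<Longrightarrow> 0 < sinc_mass q w"
  using sinc_mass_ge[of w q] by (rule less_le_trans[rotated]) auto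

lemma measurable_sinc_density [measurable]: "sinc_density q w \<in> borel_measurable borel"
  unfolding sinc_density_def by measurable

lemma sinc_density_nonneg: "0 < w \<Longrightarrow> 2 \<le> q \<Longrightarrow> even q \<Longrightarrow> 0 \<le> sinc_density q w x"
  using sinc_mass_pos[of w q] by (simp add: sinc_density_def sinc_power_nonneg)

lemma prob_space_sinc_noise:
  assumes w: "0 < w" and q: "2 \<le> q" "even q"
  shows "prob_space (sinc_noise q w)"
proof (rule prob_spaceI)
  have "(\<integral>\<^sup>+ x. ennreal (sinc_density q w x) \<partial>lborel) = ennreal (\<integral>x. sinc_density q w x \<partial>lborel)"
    using integrable_sinc_power[OF w q(1)] sinc_density_nonneg[OF w q]
    by (intro nn_integral_eq_integral) (auto simp: sinc_density_def)
  also have "(\<integral>x. sinc_density q w x \<partial>lborel) = 1"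
    using sinc_mass_pos[OF w q] by (simp add: sinc_density_def sinc_mass_def)
  finally show "emeasure (sinc_noise q w) (space (sinc_noise q w)) = 1"
    by (simp add: emeasure_density)
qed

lemma scaled_power_envelope_integral_le:
  assumes w: "0 < w" and q: "n + 2 \<le> q" "even q"
  shows "(\<integral>\<^sup>+ y. ennreal (\<bar>y\<bar> ^ n * (envelope (2 * w) q y / sinc_mass q w)) \<partial>lborel)
    \<le> ennreal (8 * real q * (2 * w) ^ n)"
proof -
  have Z: "0 < sinc_mass q w" "w / real q \<le> sinc_mass q w"
    using sinc_mass_pos[of w q] sinc_mass_ge[of w q] w q by auto
  have "(\<integral>\<^sup>+ y. ennreal (\<bar>y\<bar> ^ n * (envelope (2 * w) q y / sinc_mass q w)) \<partial>lborel)
      = (\<integral>\<^sup>+ y. ennreal (1 / sinc_mass q w) * ennreal (\<bar>y\<bar> ^ n * envelope (2 * w) q y) \<partial>lborel)"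
    using Z w by (intro nn_integral_cong) (simp add: ennreal_mult[symmetric] envelope_nonneg)
  also have "\<dots> = ennreal (1 / sinc_mass q w) * (\<integral>\<^sup>+ y. ennreal (\<bar>y\<bar> ^ n * envelope (2 * w) q y) \<partial>lborel)"
    by (rule nn_integral_cmult) measurable
  also have "\<dots> \<le> ennreal (1 / sinc_mass q w) * ennreal (4 * (2 * w) ^ (n + 1))"
    using w q by (intro mult_left_mono nn_integral_power_envelope_le) auto
  also have "\<dots> = ennreal (4 * (2 * w) ^ (n + 1) / sinc_mass q w)"
    using Z w by (simp add: ennreal_mult[symmetric])
  also have "\<dots> \<le> ennreal (4 * (2 * w) ^ (n + 1) / (w / real q))"
    using Z w q by (intro ennreal_leI divide_left_mono) auto
  also have "4 * (2 * w) ^ (n + 1) / (w / real q) = 8 * real q * (2 * w) ^ n"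
    using w by (simp add: field_simps)
  finally show ?thesis .
qed

lemma sinc_noise_moment_le:
  assumes w: "0 < w" and q: "n + 2 \<le> q" "even q"
  shows "(\<integral>\<^sup>+ v. ennreal (\<bar>v\<bar> ^ n) \<partial>sinc_noise q w) \<le> ennreal (8 * real q * (2 * w) ^ n)"
proof -
  have Z: "0 < sinc_mass q w"
    using sinc_mass_pos[of w q] w q by auto
  have d: "0 \<le> sinc_density q w v" for v
    using w q by (intro sinc_density_nonneg) auto
  have le: "sinc_density q w v * \<bar>v\<bar> ^ n \<le> \<bar>v\<bar> ^ n * (envelope (2 * w) q v / sinc_mass q w)" for v
    unfolding sinc_density_def mult.commute[of _ "\<bar>v\<bar> ^ n"]
    using Z abs_sinc_power_le_envelope[OF w, of q v]
    by (intro mult_left_mono divide_right_mono) auto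
  have "(\<integral>\<^sup>+ v. ennreal (\<bar>v\<bar> ^ n) \<partial>sinc_noise q w)
      = (\<integral>\<^sup>+ v. ennreal (sinc_density q w v) * ennreal (\<bar>v\<bar> ^ n) \<partial>lborel)"
    by (rule nn_integral_density) measurable
  also have "\<dots> \<le> (\<integral>\<^sup>+ y. ennreal (\<bar>y\<bar> ^ n * (envelope (2 * w) q y / sinc_mass q w)) \<partial>lborel)"
    using d le by (intro nn_integral_mono) (simp add: ennreal_mult[symmetric] ennreal_leI del: times_divide_eq_right)
  also have "\<dots> \<le> ennreal (8 * real q * (2 * w) ^ n)"
    by (rule scaled_power_envelope_integral_le[OF w q])
  finally show ?thesis .
qed

definition smoothed_density :: "nat \<Rightarrow> real \<Rightarrow> real measure \<Rightarrow> real \<Rightarrow> real" where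
  "smoothed_density q w M s = (\<integral>x. sinc_density q w (s - x) \<partial>M)"

lemma measurable_smoothed_density:
  assumes "real_distribution M"
  shows "smoothed_density q w M \<in> borel_measurable borel"
proof -
  interpret real_distribution M by fact
  show ?thesis
    unfolding smoothed_density_def by measurable
qed

lemma smoothed_density_nonneg:
  "0 < w \<Longrightarrow> 2 \<le> q \<Longrightarrow> even q \<Longrightarrow> 0 \<le> smoothed_density q w M s"
  unfolding smoothed_density_def by (intro integral_nonneg_AE AE_I2 sinc_density_nonneg)

text \<open>
  Conditionally on the value \<open>x\<close> of the first summand the sum has density \<open>s \<mapsto> K (s - x)\<close>; averaging over
  \<open>x\<close> gives the density of the sum.
\<close>
lemma convolution_sinc_noise:
  assumes M: "real_distribution M" and w: "0 < w" and q: "2 \<le> q" "even q"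
  shows "(M \<star> sinc_noise q w) = density lborel (\<lambda>s. ennreal (smoothed_density q w M s))"
proof (rule measure_eqI)
  interpret M: real_distribution M by fact
  interpret N: prob_space "sinc_noise q w" by (rule prob_space_sinc_noise[OF w q])
  interpret pair_sigma_finite M lborel ..
  note [measurable] = measurable_smoothed_density[OF M]
  fix A assume "A \<in> sets (M \<star> sinc_noise q w)"
  then have A [measurable]: "A \<in> sets borel" by simp
  have sd: "ennreal (smoothed_density q w M s) = (\<integral>\<^sup>+ x. ennreal (sinc_density q w (s - x)) \<partial>M)" for s
    unfolding smoothed_density_def
  proof (rule nn_integral_eq_integral[symmetric])
    show "integrable M (\<lambda>x. sinc_density q w (s - x))"
    proof (rule M.integrable_const_bound[where B = "1 / sinc_mass q w"])
      show "AE x in M. norm (sinc_density q w (s - x)) \<le> 1 / sinc_mass q w"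
        using sinc_mass_pos[OF w q] by (simp add: sinc_density_def abs_sinc_power_le divide_right_mono)
    qed measurable
  qed (simp add: sinc_density_nonneg[OF w q])
  have "emeasure (M \<star> sinc_noise q w) A = (\<integral>\<^sup>+ x. \<integral>\<^sup>+ v. indicator A (x + v) \<partial>sinc_noise q w \<partial>M)"
    by (rule convolution_emeasure') (auto intro: M.finite_measure_axioms N.finite_measure_axioms)
  also have "\<dots> = (\<integral>\<^sup>+ x. \<integral>\<^sup>+ v. ennreal (sinc_density q w v) * indicator A (x + v) \<partial>lborel \<partial>M)"
    by (intro nn_integral_cong nn_integral_density) measurable
  also have "\<dots> = (\<integral>\<^sup>+ x. \<integral>\<^sup>+ s. ennreal (sinc_density q w (s - x)) * indicator A s \<partial>lborel \<partial>M)"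
  proof (rule nn_integral_cong)
    fix x :: real
    show "(\<integral>\<^sup>+ v. ennreal (sinc_density q w v) * indicator A (x + v) \<partial>lborel)
        = (\<integral>\<^sup>+ s. ennreal (sinc_density q w (s - x)) * indicator A s \<partial>lborel)"
      by (subst nn_integral_real_affine[where c = 1 and t = "- x"]) auto
  qed
  also have "\<dots> = (\<integral>\<^sup>+ s. \<integral>\<^sup>+ x. ennreal (sinc_density q w (s - x)) * indicator A s \<partial>M \<partial>lborel)"
    by (rule Fubini'[symmetric]) measurable
  also have "\<dots> = (\<integral>\<^sup>+ s. ennreal (smoothed_density q w M s) * indicator A s \<partial>lborel)"
    unfolding sd by (intro nn_integral_cong nn_integral_multc) measurable
  also have "\<dots> = emeasure (density lborel (\<lambda>s. ennreal (smoothed_density q w M s))) A"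
    by (rule emeasure_density[symmetric]) measurable
  finally show "emeasure (M \<star> sinc_noise q w) A
      = emeasure (density lborel (\<lambda>s. ennreal (smoothed_density q w M s))) A" .
qed simp

lemma prob_space_convolution:
  assumes "real_distribution M" "real_distribution N"
  shows "prob_space (M \<star> N)"
proof -
  interpret M: real_distribution M by fact
  interpret N: real_distribution N by fact
  interpret pair_prob_space M N ..
  show ?thesis
    unfolding convolution_def by (rule prob_space_distr) measurable
qed

text \<open>
  Adding the noise is itself a coupling of \<open>M\<close> with the convolution, of cost equal to the moment of the
  noise, and the monotone coupling does not cost more.
\<close>
lemma quantile_distance_to_convolution_le:
  assumes M: "real_distribution M" and N: "real_distribution N" and n: "2 \<le> n"
  shows "(\<integral>\<^sup>+ u. ennreal (\<bar>quantile M u - quantile (M \<star> N) u\<bar> ^ n) \<partial>unit_interval)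
    \<le> (\<integral>\<^sup>+ v. ennreal (\<bar>v\<bar> ^ n) \<partial>N)"
proof -
  interpret M: real_distribution M by fact
  interpret N: real_distribution N by fact
  interpret P: pair_prob_space M N ..
  have d1: "distr (M \<Otimes>\<^sub>M N) borel fst = M"
    using N.distr_pair_fst[of M] by (simp cong: distr_cong)
  have d2: "distr (M \<Otimes>\<^sub>M N) borel (\<lambda>z. fst z + snd z) = (M \<star> N)"
    unfolding convolution_def by (simp only: case_prod_beta')
  have "(\<integral>\<^sup>+ u. ennreal (\<bar>quantile (distr (M \<Otimes>\<^sub>M N) borel fst) u
        - quantile (distr (M \<Otimes>\<^sub>M N) borel (\<lambda>z. fst z + snd z)) u\<bar> ^ n) \<partial>unit_interval)
    \<le> (\<integral>\<^sup>+ z. ennreal (\<bar>fst z - (fst z + snd z)\<bar> ^ n) \<partial>(M \<Otimes>\<^sub>M N))"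
    by (rule quantile_coupling_optimal[OF P.P.prob_space_axioms _ _ n]) measurable
  also have "\<dots> = (\<integral>\<^sup>+ z. ennreal (\<bar>snd z\<bar> ^ n) \<partial>(M \<Otimes>\<^sub>M N))"
    by simp
  also have "\<dots> = (\<integral>\<^sup>+ x. \<integral>\<^sup>+ v. ennreal (\<bar>v\<bar> ^ n) \<partial>N \<partial>M)"
    by (subst N.nn_integral_fst[symmetric]) auto
  also have "\<dots> = (\<integral>\<^sup>+ v. ennreal (\<bar>v\<bar> ^ n) \<partial>N)"
    by (simp add: M.emeasure_space_1[simplified])
  finally show ?thesis
    unfolding d1 d2 .
qed

section \<open>Smoothed densities as moment series\<close>

lemma sum_power_fact_le_exp:
  fixes y :: real
  assumes "0 \<le> y"
  shows "(\<Sum>l<N. y ^ l / fact l) \<le> exp y"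
proof -
  have "(\<lambda>l. y ^ l / fact l) sums exp y"
    using exp_converges[of y] by (simp add: field_simps)
  then show ?thesis
    using assms sum_le_suminf[of "\<lambda>l. y ^ l / fact l" "{..<N}"]
    by (simp add: sums_iff)
qed

lemma integrable_exp_abs:
  assumes M: "real_distribution M" and mgf: "\<forall>t. mgf M t < \<infinity>"
  shows "integrable M (\<lambda>x. exp (c * \<bar>x\<bar>))"
proof -
  interpret real_distribution M by fact
  have "integrable M (\<lambda>x. exp (t * x))" for t
    using mgf by (intro integrableI_bounded) (auto simp: mgf_def)
  then have "integrable M (\<lambda>x. exp (c * x) + exp (- c * x))"
    by (intro Bochner_Integration.integrable_add)
  then show ?thesis
  proof (rule Bochner_Integration.integrable_bound)
    have "exp (c * \<bar>x\<bar>) \<le> exp (c * x) + exp (- c * x)" for x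
      by (cases "0 \<le> x") auto
    then show "AE x in M. norm (exp (c * \<bar>x\<bar>)) \<le> norm (exp (c * x) + exp (- c * x))"
      by (intro AE_I2) (smt (verit) exp_gt_zero real_norm_def)
  qed simp
qed

lemma integrable_abs_power:
  assumes M: "real_distribution M" and mgf: "\<forall>t. mgf M t < \<infinity>"
  shows "integrable M (\<lambda>x. \<bar>x\<bar> ^ l)"
proof -
  interpret real_distribution M by fact
  have "integrable M (\<lambda>x. fact l * exp (1 * \<bar>x\<bar>))"
    by (intro integrable_mult_right integrable_exp_abs[OF M mgf])
  then show ?thesis
  proof (rule Bochner_Integration.integrable_bound)
    have "\<bar>x\<bar> ^ l \<le> fact l * exp \<bar>x\<bar>" for x :: real
    proof -
      have "\<bar>x\<bar> ^ l / fact l \<le> (\<Sum>k<Suc l. \<bar>x\<bar> ^ k / fact k)"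
        by (rule member_le_sum) auto
      also have "\<dots> \<le> exp \<bar>x\<bar>"
        by (rule sum_power_fact_le_exp) simp
      finally show ?thesis by (simp add: field_simps)
    qed
    then show "AE x in M. norm (\<bar>x\<bar> ^ l) \<le> norm (fact l * exp (1 * \<bar>x\<bar>))"
      by simp
  qed simp
qed

text \<open>
  The partial sums are expectations of partial sums of the exponential series of \<open>c \<bar>x\<bar>\<close>, hence bounded by
  an exponential moment.
\<close>
lemma summable_exponential_abs_moments:
  assumes M: "real_distribution M" and mgf: "\<forall>t. mgf M t < \<infinity>" and c: "0 \<le> c"
  shows "summable (\<lambda>l. c ^ l / fact l * (\<integral>x. \<bar>x\<bar> ^ l \<partial>M))"
proof (rule summableI_nonneg_bounded)
  fix N
  note int = integrable_abs_power[OF M mgf]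
  have "(\<Sum>l<N. c ^ l / fact l * (\<integral>x. \<bar>x\<bar> ^ l \<partial>M)) = (\<integral>x. (\<Sum>l<N. c ^ l / fact l * \<bar>x\<bar> ^ l) \<partial>M)"
    using int by (subst Bochner_Integration.integral_sum) auto
  also have "\<dots> \<le> (\<integral>x. exp (c * \<bar>x\<bar>) \<partial>M)"
  proof (rule integral_mono)
    fix x
    show "(\<Sum>l<N. c ^ l / fact l * \<bar>x\<bar> ^ l) \<le> exp (c * \<bar>x\<bar>)"
      using sum_power_fact_le_exp[of "c * \<bar>x\<bar>" N] c by (simp add: power_mult_distrib)
  qed (use int integrable_exp_abs[OF M mgf] in auto)
  finally show "(\<Sum>l<N. c ^ l / fact l * (\<integral>x. \<bar>x\<bar> ^ l \<partial>M)) \<le> (\<integral>x. exp (c * \<bar>x\<bar>) \<partial>M)" .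
qed (use c in auto)

text \<open>
  Termwise integration of an entire function of exponential type: the finite moment generating function is
  what makes the series of absolute moments converge, for every type \<open>c\<close>.
\<close>
lemma expectation_power_series_sums:
  assumes M: "real_distribution M" and mgf: "\<forall>t. mgf M t < \<infinity>" and c: "0 \<le> c"
    and a: "\<And>l. \<bar>a l\<bar> \<le> c ^ l / fact l"
    and f: "\<And>x. (\<lambda>l. a l * x ^ l) sums f x"
  shows "(\<lambda>l. a l * (\<integral>x. x ^ l \<partial>M)) sums (\<integral>x. f x \<partial>M)"
proof -
  interpret real_distribution M by fact
  note int = integrable_abs_power[OF M mgf]
  have int': "integrable M (\<lambda>x. x ^ l)" for l
    by (rule Bochner_Integration.integrable_bound[OF int[of l]]) (auto simp: power_abs)
  have "(\<lambda>l. \<integral>x. a l * x ^ l \<partial>M) sums (\<integral>x. (\<Sum>l. a l * x ^ l) \<partial>M)"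
  proof (rule sums_integral)
    show "integrable M (\<lambda>x. a l * x ^ l)" for l
      using int' by simp
    show "AE x in M. summable (\<lambda>l. norm (a l * x ^ l))"
    proof (rule AE_I2)
      fix x
      have "summable (\<lambda>l. (c * \<bar>x\<bar>) ^ l / fact l)"
        using exp_converges[of "c * \<bar>x\<bar>"] by (auto simp: sums_iff field_simps)
      then show "summable (\<lambda>l. norm (a l * x ^ l))"
      proof (rule summable_comparison_test')
        fix l :: nat
        show "norm (norm (a l * x ^ l)) \<le> (c * \<bar>x\<bar>) ^ l / fact l"
          using mult_right_mono[OF a[of l], of "\<bar>x\<bar> ^ l"]
          by (simp add: abs_mult power_abs power_mult_distrib)
      qed
    qed
    show "summable (\<lambda>l. \<integral>x. norm (a l * x ^ l) \<partial>M)"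
    proof (rule summable_comparison_test'[OF summable_exponential_abs_moments[OF M mgf c]])
      fix l :: nat
      have "(\<integral>x. norm (a l * x ^ l) \<partial>M) = \<bar>a l\<bar> * (\<integral>x. \<bar>x\<bar> ^ l \<partial>M)"
        by (simp add: abs_mult power_abs[symmetric])
      then show "norm (\<integral>x. norm (a l * x ^ l) \<partial>M) \<le> c ^ l / fact l * (\<integral>x. \<bar>x\<bar> ^ l \<partial>M)"
        using mult_right_mono[OF a[of l], of "\<integral>x. \<bar>x\<bar> ^ l \<partial>M"] by simp
    qed
  qed
  then show ?thesis
    using f by (simp add: sums_iff)
qed

text \<open>
  The expectation of the kernel centred at \<open>x\<close>, expanded in the moments of \<open>M\<close>: the Taylor series of the
  kernel at \<open>x / w\<close> is evaluated at the increment \<open>- y / w\<close>.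
\<close>
lemma expectation_sinc_power_sums:
  assumes M: "real_distribution M" and mgf: "\<forall>t. mgf M t < \<infinity>" and w: "0 < w" and q: "0 < q"
  shows "(\<lambda>l. Re (sinc_power_coeff q (x / w) l) * (- 1 / w) ^ l * (\<integral>y. y ^ l \<partial>M))
    sums (\<integral>y. sinc_power q ((x - y) / w) \<partial>M)"
proof (rule expectation_power_series_sums[OF M mgf])
  show "0 \<le> exp 1 * real q / w" using w by simp
  show "\<bar>Re (sinc_power_coeff q (x / w) l) * (- 1 / w) ^ l\<bar> \<le> (exp 1 * real q / w) ^ l / fact l" for l
  proof (cases "l = 0")
    case True
    have "\<bar>Re (sinc_power_coeff q (x / w) 0)\<bar> = \<bar>sinc_power q (x / w)\<bar>"
      by (simp add: sinc_power_coeff_def csinc_of_real_power del: of_real_divide)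
    then show ?thesis
      using True abs_sinc_power_le(1)[of q "x / w"] by simp
  next
    case False
    have "\<bar>Re (sinc_power_coeff q (x / w) l)\<bar> \<le> (exp 1 * real q / real l) ^ l"
      using norm_sinc_power_coeff_le[of q l "x / w"] abs_Re_le_cmod order_trans q False by blast
    also have "\<dots> = (exp 1 * real q) ^ l / real l ^ l"
      by (simp add: power_divide)
    also have "\<dots> \<le> (exp 1 * real q) ^ l / fact l"
      using False fact_le_power[of l, where ?'a = real] by (intro divide_left_mono) auto
    finally have "\<bar>Re (sinc_power_coeff q (x / w) l)\<bar> * (1 / w) ^ l \<le> (exp 1 * real q) ^ l / fact l * (1 / w) ^ l"
      using w by (intro mult_right_mono) auto
    then show ?thesis
      using w by (simp add: abs_mult power_abs power_divide mult.commute)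
  qed
  show "(\<lambda>l. Re (sinc_power_coeff q (x / w) l) * (- 1 / w) ^ l * y ^ l) sums sinc_power q ((x - y) / w)" for y
    using sinc_power_sums[of q "x / w" "- y / w"]
    by (simp add: diff_divide_distrib power_divide power_minus' mult.assoc)
qed

text \<open>
  Both coefficient estimates in one, with \<open>9\<close> as a bound for \<open>exp 2\<close>.
\<close>
lemma norm_sinc_power_coeff_le_envelope:
  assumes w: "0 < w" and q: "0 < q" and l: "0 < l"
  shows "norm (sinc_power_coeff q (x / w) l) \<le> (9 * real q / real l) ^ l * envelope (2 * w) q x"
proof -
  have e1: "exp 1 \<le> (9 :: real)" and e2: "exp 2 \<le> (9 :: real)"
  proof -
    have "exp 2 = exp 1 * (exp 1 :: real)"
      by (simp add: exp_add[symmetric])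
    also have "\<dots> \<le> 3 * 3"
      using exp_le by (intro mult_mono) auto
    finally show "exp 2 \<le> (9 :: real)" by simp
    show "exp 1 \<le> (9 :: real)" using exp_le by linarith
  qed
  show ?thesis
  proof (cases "\<bar>x\<bar> \<le> 2 * w")
    case True
    have "norm (sinc_power_coeff q (x / w) l) \<le> (exp 1 * real q / real l) ^ l"
      by (rule norm_sinc_power_coeff_le[OF q l])
    also have "\<dots> \<le> (9 * real q / real l) ^ l"
      using e1 by (intro power_mono divide_right_mono mult_right_mono) auto
    finally show ?thesis
      using True by (simp add: envelope_def)
  next
    case False
    then have "norm (sinc_power_coeff q (x / w) l) \<le> (exp 2 * real q / real l) ^ l * (2 / \<bar>x / w\<bar>) ^ q"
      using w by (intro norm_sinc_power_coeff_le_decay[OF q l]) auto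
    also have "\<dots> \<le> (9 * real q / real l) ^ l * (2 / \<bar>x / w\<bar>) ^ q"
      using e2 by (intro mult_right_mono power_mono divide_right_mono) auto
    finally show ?thesis
      using False w by (simp add: envelope_def)
  qed
qed

text \<open>
  The heart of the argument. The term of order zero cancels because both measures are probabilities. In the
  term of order \<open>l\<close> the coefficient bound \<open>(9 q / l)^l\<close>, the scaling \<open>w^(-l)\<close> and the moment bound \<open>(m l)^l\<close>
  multiply to \<open>(9 q m / w)^l\<close>, in which \<open>l\<close> has cancelled. The width \<open>w = 18 q m\<close> turns this into
  \<open>(1/2)^l\<close>, so that the series sums to the envelope itself.
\<close>
lemma smoothed_density_diff_le:
  assumes M: "real_distribution M" and mgfM: "\<forall>t. mgf M t < \<infinity>"
    and N: "real_distribution N" and mgfN: "\<forall>t. mgf N t < \<infinity>"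
    and m: "0 < m" and moments: "\<And>l. 0 < l \<Longrightarrow> \<bar>(\<integral>x. x ^ l \<partial>M) - (\<integral>x. x ^ l \<partial>N)\<bar> \<le> (m * real l) ^ l"
    and q: "2 \<le> q" "even q" and w: "w = 18 * real q * m"
  shows "\<bar>smoothed_density q w M x - smoothed_density q w N x\<bar> \<le> envelope (2 * w) q x / sinc_mass q w"
proof -
  interpret M: real_distribution M by fact
  interpret N: real_distribution N by fact
  have w0: "0 < w" and q0: "0 < q" using q m by (auto simp: w)
  define E where "E = envelope (2 * w) q x"
  have E: "0 \<le> E" using w0 by (simp add: E_def envelope_nonneg)
  define d where "d l = Re (sinc_power_coeff q (x / w) l) * (- 1 / w) ^ l * ((\<integral>y. y ^ l \<partial>M) - (\<integral>y. y ^ l \<partial>N))" for l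
  define D where "D = (\<integral>y. sinc_power q ((x - y) / w) \<partial>M) - (\<integral>y. sinc_power q ((x - y) / w) \<partial>N)"
  have "d sums D"
    using sums_diff[OF expectation_sinc_power_sums[OF M mgfM w0 q0, of x] expectation_sinc_power_sums[OF N mgfN w0 q0, of x]]
    by (simp add: d_def[abs_def] D_def right_diff_distrib)
  moreover have "d 0 = 0"
    using M.prob_space N.prob_space by (simp add: d_def)
  ultimately have sums: "(\<lambda>l. d (Suc l)) sums D"
    by (simp add: sums_Suc_iff)
  have bound: "norm (d (Suc k)) \<le> E * (1 / 2) ^ Suc k" for k
  proof -
    define l where "l = Suc k"
    have l: "0 < l" by (simp add: l_def)
    have "norm (d l) = \<bar>Re (sinc_power_coeff q (x / w) l)\<bar> * ((1 / w) ^ l * \<bar>(\<integral>x. x ^ l \<partial>M) - (\<integral>x. x ^ l \<partial>N)\<bar>)"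
      using w0 by (simp add: d_def abs_mult power_abs power_divide)
    also have "\<dots> \<le> ((9 * real q / real l) ^ l * E) * ((1 / w) ^ l * (m * real l) ^ l)"
      unfolding E_def
      using norm_sinc_power_coeff_le_envelope[OF w0 q0 l, of x] abs_Re_le_cmod[of "sinc_power_coeff q (x / w) l"] w0 m E[unfolded E_def]
      by (intro mult_mono moments[OF l]) auto
    also have "\<dots> = E * ((9 * real q / real l) * (1 / w) * (m * real l)) ^ l"
      by (simp only: power_mult_distrib mult_ac)
    also have "(9 * real q / real l) * (1 / w) * (m * real l) = 1 / 2"
      using q0 m l by (simp add: w field_simps)
    finally show ?thesis by (simp add: l_def)
  qed
  have half: "(\<lambda>k. E * (1 / 2) ^ Suc k) sums (E * 1)"
    by (intro sums_mult power_half_series)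
  have "norm (\<Sum>k. d (Suc k)) \<le> (\<Sum>k. E * (1 / 2) ^ Suc k)"
    by (rule norm_suminf_le[OF bound sums_summable[OF half]])
  then have "\<bar>D\<bar> \<le> E"
    using sums half by (simp add: sums_iff)
  moreover have "smoothed_density q w M x - smoothed_density q w N x = D / sinc_mass q w"
    by (simp add: smoothed_density_def sinc_density_def D_def diff_divide_distrib)
  ultimately show ?thesis
    using sinc_mass_pos[OF w0 q] by (simp add: E_def divide_right_mono)
qed

section \<open>From moments to the Wasserstein distance\<close>

lemma abs_add3_power_le:
  fixes a b c :: real
  shows "\<bar>a + b + c\<bar> ^ n \<le> 3 ^ n * (\<bar>a\<bar> ^ n + \<bar>b\<bar> ^ n + \<bar>c\<bar> ^ n)"
proof -
  define M where "M = max \<bar>a\<bar> (max \<bar>b\<bar> \<bar>c\<bar>)"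
  have "\<bar>a + b + c\<bar> ^ n \<le> (3 * M) ^ n"
    unfolding M_def by (intro power_mono) auto
  also have "\<dots> = 3 ^ n * M ^ n"
    by (rule power_mult_distrib)
  also have "M ^ n \<le> \<bar>a\<bar> ^ n + \<bar>b\<bar> ^ n + \<bar>c\<bar> ^ n"
    unfolding M_def max_def by auto
  finally show ?thesis by simp
qed

text \<open>
  All four quantile functions are evaluated at the same uniform variable, so the triangle inequality is
  pointwise.
\<close>
lemma quantile_distance_triangle:
  assumes dist: "real_distribution M" "real_distribution M'" "real_distribution N" "real_distribution N'"
  shows "(\<integral>\<^sup>+ u. ennreal (\<bar>quantile M u - quantile N u\<bar> ^ n) \<partial>unit_interval)
    \<le> 3 ^ n * ((\<integral>\<^sup>+ u. ennreal (\<bar>quantile M u - quantile M' u\<bar> ^ n) \<partial>unit_interval)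
      + (\<integral>\<^sup>+ u. ennreal (\<bar>quantile M' u - quantile N' u\<bar> ^ n) \<partial>unit_interval)
      + (\<integral>\<^sup>+ u. ennreal (\<bar>quantile N u - quantile N' u\<bar> ^ n) \<partial>unit_interval))"
proof -
  note [measurable] = dist[THEN measurable_quantile]
  have "(\<integral>\<^sup>+ u. ennreal (\<bar>quantile M u - quantile N u\<bar> ^ n) \<partial>unit_interval)
     \<le> (\<integral>\<^sup>+ u. 3 ^ n * (ennreal (\<bar>quantile M u - quantile M' u\<bar> ^ n)
        + ennreal (\<bar>quantile M' u - quantile N' u\<bar> ^ n)
        + ennreal (\<bar>quantile N u - quantile N' u\<bar> ^ n)) \<partial>unit_interval)"
  proof (rule nn_integral_mono)
    fix u
    have "\<bar>quantile M u - quantile N u\<bar> ^ n \<le> 3 ^ n * (\<bar>quantile M u - quantile M' u\<bar> ^ n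
        + \<bar>quantile M' u - quantile N' u\<bar> ^ n + \<bar>quantile N u - quantile N' u\<bar> ^ n)"
      using abs_add3_power_le[of "quantile M u - quantile M' u" "quantile M' u - quantile N' u"
          "quantile N' u - quantile N u" n] by (simp add: abs_minus_commute)
    then have "ennreal (\<bar>quantile M u - quantile N u\<bar> ^ n)
      \<le> ennreal (3 ^ n * (\<bar>quantile M u - quantile M' u\<bar> ^ n
        + \<bar>quantile M' u - quantile N' u\<bar> ^ n + \<bar>quantile N u - quantile N' u\<bar> ^ n))"
      by (rule ennreal_leI)
    also have "\<dots> = 3 ^ n * (ennreal (\<bar>quantile M u - quantile M' u\<bar> ^ n)
        + ennreal (\<bar>quantile M' u - quantile N' u\<bar> ^ n)
        + ennreal (\<bar>quantile N u - quantile N' u\<bar> ^ n))"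
      by (simp add: ennreal_mult ennreal_power[symmetric])
    finally show "ennreal (\<bar>quantile M u - quantile N u\<bar> ^ n)
      \<le> 3 ^ n * (ennreal (\<bar>quantile M u - quantile M' u\<bar> ^ n)
        + ennreal (\<bar>quantile M' u - quantile N' u\<bar> ^ n)
        + ennreal (\<bar>quantile N u - quantile N' u\<bar> ^ n))" .
  qed
  also have "\<dots> = 3 ^ n * ((\<integral>\<^sup>+ u. ennreal (\<bar>quantile M u - quantile M' u\<bar> ^ n) \<partial>unit_interval)
      + (\<integral>\<^sup>+ u. ennreal (\<bar>quantile M' u - quantile N' u\<bar> ^ n) \<partial>unit_interval)
      + (\<integral>\<^sup>+ u. ennreal (\<bar>quantile N u - quantile N' u\<bar> ^ n) \<partial>unit_interval))"
    by (simp add: nn_integral_cmult nn_integral_add)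
  finally show ?thesis .
qed

lemma quantile_distance_smoothed_le:
  assumes M: "real_distribution M" and mgfM: "\<forall>t. mgf M t < \<infinity>"
    and N: "real_distribution N" and mgfN: "\<forall>t. mgf N t < \<infinity>"
    and m: "0 < m" and moments: "\<And>l. 0 < l \<Longrightarrow> \<bar>(\<integral>x. x ^ l \<partial>M) - (\<integral>x. x ^ l \<partial>N)\<bar> \<le> (m * real l) ^ l"
    and n: "0 < n" and q: "n + 2 \<le> q" "even q" and w: "w = 18 * real q * m"
  shows "(\<integral>\<^sup>+ u. ennreal (\<bar>quantile (M \<star> sinc_noise q w) u - quantile (N \<star> sinc_noise q w) u\<bar> ^ n) \<partial>unit_interval)
    \<le> 2 ^ n * ennreal (8 * real q * (2 * w) ^ n)"
proof -
  have w0: "0 < w" and q2: "2 \<le> q" using m q by (auto simp: w)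
  have conv: "(M \<star> sinc_noise q w) = density lborel (\<lambda>s. ennreal (smoothed_density q w M s))"
    "(N \<star> sinc_noise q w) = density lborel (\<lambda>s. ennreal (smoothed_density q w N s))"
    using convolution_sinc_noise w0 q2 q(2) M N by blast+
  have noise: "real_distribution (sinc_noise q w)"
    using prob_space_sinc_noise[OF w0 q2 q(2)] by (simp add: real_distribution_def real_distribution_axioms_def)
  note prob = prob_space_convolution[OF M noise, unfolded conv] prob_space_convolution[OF N noise, unfolded conv]
  note [measurable] = measurable_smoothed_density[OF M] measurable_smoothed_density[OF N]
  have "(\<integral>\<^sup>+ u. ennreal (\<bar>quantile (M \<star> sinc_noise q w) u - quantile (N \<star> sinc_noise q w) u\<bar> ^ n) \<partial>unit_interval)
      \<le> 2 ^ n * (\<integral>\<^sup>+ y. ennreal (\<bar>y\<bar> ^ n * \<bar>smoothed_density q w M y - smoothed_density q w N y\<bar>) \<partial>lborel)"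
    unfolding conv
    by (rule quantile_distance_le_weighted_density_distance[OF _ _ _ _ prob n])
      (auto intro: smoothed_density_nonneg w0 q2 q(2))
  also have "\<dots> \<le> 2 ^ n * (\<integral>\<^sup>+ y. ennreal (\<bar>y\<bar> ^ n * (envelope (2 * w) q y / sinc_mass q w)) \<partial>lborel)"
    by (intro mult_left_mono nn_integral_mono ennreal_leI
        smoothed_density_diff_le[OF M mgfM N mgfN m moments q2 q(2) w]) auto
  also have "\<dots> \<le> 2 ^ n * ennreal (8 * real q * (2 * w) ^ n)"
    by (intro mult_left_mono scaled_power_envelope_integral_le[OF w0 q]) auto
  finally show ?thesis .
qed

lemma eight_power_ge: "2 \<le> n \<Longrightarrow> 16 * (real n + 2) \<le> 8 ^ n"
proof (induction n rule: dec_induct)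
  case (step n)
  then have "16 * (real (Suc n) + 2) \<le> 8 * (16 * (real n + 2))" by simp
  also have "\<dots> \<le> 8 * 8 ^ n" using step by (intro mult_left_mono) auto
  finally show ?case by simp
qed simp

text \<open>
  The two noise terms and the smoothed term add up to \<open>3^n (2 + 2^n) 8 q (2 w)^n\<close>. With \<open>q = n + 2\<close> this is
  at most \<open>(96 w)^n\<close>, and \<open>w = 18 (n + 2) m\<close> is at most \<open>36 n m\<close>.
\<close>
lemma quantile_distance_power_le:
  assumes M: "real_distribution M" and mgfM: "\<forall>t. mgf M t < \<infinity>"
    and N: "real_distribution N" and mgfN: "\<forall>t. mgf N t < \<infinity>"
    and m: "0 < m" and moments: "\<And>l. 0 < l \<Longrightarrow> \<bar>(\<integral>x. x ^ l \<partial>M) - (\<integral>x. x ^ l \<partial>N)\<bar> \<le> (m * real l) ^ l"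
    and n: "2 \<le> n" "even n"
  shows "(\<integral>\<^sup>+ u. ennreal (\<bar>quantile M u - quantile N u\<bar> ^ n) \<partial>unit_interval)
    \<le> ennreal ((3456 * real n * m) ^ n)"
proof -
  define q where "q = n + 2"
  define w where "w = 18 * real q * m"
  define \<rho> where "\<rho> = sinc_noise q w"
  have q: "n + 2 \<le> q" "even q" and w0: "0 < w"
    using n m by (auto simp: q_def w_def)
  have noise: "real_distribution \<rho>"
    using prob_space_sinc_noise[OF w0 _ q(2)] q(1) by (simp add: \<rho>_def real_distribution_def real_distribution_axioms_def)
  have conv: "real_distribution (M \<star> \<rho>)" "real_distribution (N \<star> \<rho>)"
    using prob_space_convolution[OF M noise] prob_space_convolution[OF N noise]
    by (auto simp: real_distribution_def real_distribution_axioms_def)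
  have to_conv: "(\<integral>\<^sup>+ u. ennreal (\<bar>quantile L u - quantile (L \<star> \<rho>) u\<bar> ^ n) \<partial>unit_interval)
      \<le> ennreal (8 * real q * (2 * w) ^ n)" if "real_distribution L" for L
    using quantile_distance_to_convolution_le[OF that noise n(1)] sinc_noise_moment_le[OF w0 q]
    unfolding \<rho>_def by (rule order_trans)
  have "(\<integral>\<^sup>+ u. ennreal (\<bar>quantile M u - quantile N u\<bar> ^ n) \<partial>unit_interval)
      \<le> 3 ^ n * (ennreal (8 * real q * (2 * w) ^ n) + 2 ^ n * ennreal (8 * real q * (2 * w) ^ n)
        + ennreal (8 * real q * (2 * w) ^ n))"
    using n by (intro order_trans[OF quantile_distance_triangle[OF M conv(1) N conv(2)]] mult_left_mono add_mono
        to_conv M N quantile_distance_smoothed_le[OF M mgfM N mgfN m moments _ q w_def, folded \<rho>_def]) auto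
  also have "\<dots> = ennreal (3 ^ n * (2 + 2 ^ n) * (8 * real q * (2 * w) ^ n))"
  proof -
    define z where "z = 8 * real q * (2 * w) ^ n"
    have z: "0 \<le> z" using w0 by (simp add: z_def)
    have "ennreal (3 ^ n * (2 + 2 ^ n) * z) = 3 ^ n * ((2 + 2 ^ n) * ennreal z)"
      using z by (simp add: ennreal_mult ennreal_power[symmetric] mult.assoc)
    also have "(2 + 2 ^ n) * ennreal z = ennreal z + 2 ^ n * ennreal z + ennreal z"
      by (simp only: distrib_right mult_2 add_ac)
    finally show ?thesis unfolding z_def by simp
  qed
  also have "\<dots> \<le> ennreal ((3456 * real n * m) ^ n)"
  proof (rule ennreal_leI)
    have "(2 :: real) ^ 1 \<le> 2 ^ n"
      using n by (intro power_increasing) simp_all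
    then have "3 ^ n * (2 + 2 ^ n) \<le> 3 ^ n * (2 * 2 ^ n :: real)"
      by (intro mult_left_mono) simp_all
    then have "3 ^ n * (2 + 2 ^ n) * (8 * real q * (2 * w) ^ n) \<le> 3 ^ n * (2 * 2 ^ n) * (8 * real q * (2 * w) ^ n)"
      using w0 by (intro mult_right_mono) simp_all
    also have "\<dots> = (16 * (real n + 2)) * (3 ^ n * 2 ^ n * (2 * w) ^ n)"
      by (simp add: q_def)
    also have "\<dots> = (16 * (real n + 2)) * (12 * w) ^ n"
      using power_mult_distrib[of "3 * 2" "2 * w" n] power_mult_distrib[of 3 "2 :: real" n]
      by (auto simp: mult.assoc)
    also have "\<dots> \<le> 8 ^ n * (12 * w) ^ n"
      using w0 eight_power_ge[OF n(1)] by (intro mult_right_mono) auto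
    also have "\<dots> = (8 * (12 * w)) ^ n"
      by (rule power_mult_distrib[symmetric])
    also have "\<dots> \<le> (3456 * real n * m) ^ n"
    proof (rule power_mono)
      have "w \<le> 36 * real n * m"
        unfolding w_def q_def using n m by (intro mult_right_mono) auto
      then show "8 * (12 * w) \<le> 3456 * real n * m" by linarith
    qed (use w0 in auto)
    finally show "3 ^ n * (2 + 2 ^ n) * (8 * real q * (2 * w) ^ n) \<le> (3456 * real n * m) ^ n" .
  qed
  finally show ?thesis .
qed

lemma quantile_coupling:
  assumes M: "real_distribution M" and N: "real_distribution N"
  shows "distr unit_interval (borel \<Otimes>\<^sub>M borel) (\<lambda>u. (quantile M u, quantile N u)) \<in> couplings M N"
proof -
  interpret prob_space unit_interval by (rule prob_space_unit_interval)
  note [measurable] = measurable_quantile[OF M] measurable_quantile[OF N]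
  show ?thesis
    unfolding couplings_def
    by (auto simp: distr_distr comp_def distr_quantile M N intro!: prob_space_distr)
qed

text \<open>
  A substitute for Jensen's inequality: values below the level \<open>A\<close> contribute at most \<open>A powr p\<close>, and above the
  level the larger exponent \<open>n\<close> takes over.
\<close>
lemma powr_le_level_plus_power:
  fixes x A p :: real
  assumes "0 < A" "0 \<le> x" "0 < p" "p \<le> real n"
  shows "x powr p \<le> A powr p + A powr (p - real n) * x ^ n"
proof (cases "x \<le> A")
  case True
  then have "x powr p \<le> A powr p"
    using assms by (intro powr_mono2) auto
  moreover have "0 \<le> A powr (p - real n) * x ^ n"
    using assms by simp
  ultimately show ?thesis by linarith
next
  case False
  then have "x powr p = x powr (p - real n) * x ^ n"
    using assms by (simp add: powr_realpow[symmetric] powr_add[symmetric])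
  also have "\<dots> \<le> A powr (p - real n) * x ^ n"
    using False assms by (intro mult_right_mono powr_mono2') auto
  finally show ?thesis
    using powr_ge_zero[of A p] by linarith
qed

lemma wasserstein_le_of_quantile_distance:
  assumes M: "real_distribution M" and N: "real_distribution N"
    and p: "1 \<le> p" "p \<le> real n" and A: "0 < A"
    and bound: "(\<integral>\<^sup>+ u. ennreal (\<bar>quantile M u - quantile N u\<bar> ^ n) \<partial>unit_interval) \<le> ennreal (A ^ n)"
  shows "wasserstein p M N \<le> ennreal (2 * A)"
proof -
  interpret prob_space unit_interval by (rule prob_space_unit_interval)
  note [measurable] = measurable_quantile[OF M] measurable_quantile[OF N]
  define \<gamma> where "\<gamma> = distr unit_interval (borel \<Otimes>\<^sub>M borel) (\<lambda>u. (quantile M u, quantile N u))"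
  define J where "J = (\<integral>\<^sup>+ (x, y). ennreal (\<bar>x - y\<bar> powr p) \<partial>\<gamma>)"
  let ?D = "\<lambda>u. \<bar>quantile M u - quantile N u\<bar>"
  have "J = (\<integral>\<^sup>+ u. ennreal (?D u powr p) \<partial>unit_interval)"
    unfolding J_def \<gamma>_def by (subst nn_integral_distr) auto
  also have "\<dots> \<le> (\<integral>\<^sup>+ u. ennreal (A powr p) + ennreal (A powr (p - real n)) * ennreal (?D u ^ n) \<partial>unit_interval)"
  proof (rule nn_integral_mono)
    fix u
    show "ennreal (?D u powr p) \<le> ennreal (A powr p) + ennreal (A powr (p - real n)) * ennreal (?D u ^ n)"
      using powr_le_level_plus_power[OF A, of "?D u" p n] p
      by (simp add: ennreal_mult[symmetric] ennreal_plus[symmetric] ennreal_leI del: ennreal_plus)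
  qed
  also have "\<dots> = ennreal (A powr p) + ennreal (A powr (p - real n)) * (\<integral>\<^sup>+ u. ennreal (?D u ^ n) \<partial>unit_interval)"
    using emeasure_space_1 by (simp add: nn_integral_add nn_integral_cmult)
  also have "\<dots> \<le> ennreal (A powr p) + ennreal (A powr (p - real n)) * ennreal (A ^ n)"
    by (intro add_left_mono mult_left_mono bound) simp
  also have "\<dots> = ennreal (2 * A powr p)"
    using A by (simp add: ennreal_mult[symmetric] ennreal_plus[symmetric] powr_realpow[symmetric] powr_add[symmetric]
        del: ennreal_plus)
  finally have J: "J \<le> ennreal (2 * A powr p)" .
  have "wasserstein p M N \<le> ennreal_powr J (1 / p)"
    unfolding wasserstein_def J_def \<gamma>_def by (rule INF_lower[OF quantile_coupling[OF M N]])
  also have "\<dots> \<le> ennreal (2 * A)"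
  proof -
    have "J \<noteq> \<top>" using J by (auto simp: top_unique)
    have "enn2real J \<le> 2 * A powr p"
      using J by (intro enn2real_leI) auto
    also have "\<dots> \<le> (2 * A) powr p"
      using A p powr_mono[of 1 p 2] by (simp add: powr_mult)
    finally have "enn2real J powr (1 / p) \<le> ((2 * A) powr p) powr (1 / p)"
      using p by (intro powr_mono2) auto
    also have "\<dots> = 2 * A"
      using A p by (simp add: powr_powr)
    finally show ?thesis
      using \<open>J \<noteq> \<top>\<close> by (simp add: ennreal_powr_def ennreal_leI)
  qed
  finally show ?thesis .
qed

text \<open>
  The even exponent \<open>n = 2 \<lceil>p\<rceil>\<close> is at most \<open>4 p\<close>, and \<open>27648 = 2 * 3456 * 4\<close>.
\<close>
lemma wasserstein_le_of_moment_bound: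
  assumes M: "real_distribution M" and mgfM: "\<forall>t. mgf M t < \<infinity>"
    and N: "real_distribution N" and mgfN: "\<forall>t. mgf N t < \<infinity>"
    and m: "0 < m" and moments: "\<And>l. 0 < l \<Longrightarrow> \<bar>(\<integral>x. x ^ l \<partial>M) - (\<integral>x. x ^ l \<partial>N)\<bar> \<le> (m * real l) ^ l"
    and p: "1 \<le> p"
  shows "wasserstein p M N \<le> ennreal (27648 * p * m)"
proof -
  define n where "n = 2 * nat \<lceil>p\<rceil>"
  have n: "2 \<le> n" "even n" "p \<le> real n" "real n \<le> 4 * p"
    using p unfolding n_def by (auto simp: of_nat_nat) linarith+
  have "wasserstein p M N \<le> ennreal (2 * (3456 * real n * m))"
    using m n by (intro wasserstein_le_of_quantile_distance[OF M N p n(3)]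
        quantile_distance_power_le[OF M mgfM N mgfN m moments]) auto
  also have "\<dots> \<le> ennreal (27648 * p * m)"
    using m n mult_right_mono[OF n(4), of m] by (intro ennreal_leI) simp
  finally show ?thesis .
qed

theorem theorem4:
  shows "\<exists>C::real. C > 0 \<and>
    (\<forall>\<mu> \<nu> :: real measure.
      real_distribution \<mu> \<longrightarrow> real_distribution \<nu> \<longrightarrow>
      (\<forall>t. mgf \<mu> t < \<infinity>) \<longrightarrow> (\<forall>t. mgf \<nu> t < \<infinity>) \<longrightarrow>
      (\<forall>p::real. 1 \<le> p \<longrightarrow>
        wasserstein p \<mu> \<nu> \<le>
          ennreal (C * p) * (SUP l \<in> {1::nat..}. ennreal (moment_dist l \<mu> \<nu> / real l))))"
proof (intro exI conjI allI impI)
  show "(0::real) < 27648" by simp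
next
  fix \<mu> \<nu> :: "real measure" and p :: real
  assume \<mu>: "real_distribution \<mu>" "\<forall>t. mgf \<mu> t < \<infinity>"
    and \<nu>: "real_distribution \<nu>" "\<forall>t. mgf \<nu> t < \<infinity>" and p: "1 \<le> p"
  define S where "S = (SUP l \<in> {1::nat..}. ennreal (moment_dist l \<mu> \<nu> / real l))"
  show "wasserstein p \<mu> \<nu> \<le> ennreal (27648 * p) * S"
  proof (cases S)
    case top
    then show ?thesis using p by (simp add: ennreal_mult_top)
  next
    case (real s)
    show ?thesis
    proof (rule ennreal_le_epsilon)
      fix e :: real assume e: "0 < e"
      \<comment> \<open>strictly positive even if the supremum vanishes, as the noise must have positive width\<close>
      define m where "m = s + e / (27648 * p)"
      have m: "0 < m" "s \<le> m" using real e p by (auto simp: m_def add_nonneg_pos)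
      have "wasserstein p \<mu> \<nu> \<le> ennreal (27648 * p * m)"
      proof (rule wasserstein_le_of_moment_bound[OF \<mu> \<nu> m(1) _ p])
        fix l :: nat assume l: "0 < l"
        then have "ennreal (moment_dist l \<mu> \<nu> / real l) \<le> ennreal s"
          unfolding real(2)[symmetric] S_def by (intro SUP_upper) auto
        then have "moment_dist l \<mu> \<nu> \<le> s * real l"
          using l real by (simp add: divide_le_eq)
        then have root: "root l \<bar>(\<integral>x. x ^ l \<partial>\<mu>) - (\<integral>y. y ^ l \<partial>\<nu>)\<bar> \<le> m * real l"
          unfolding moment_dist_def using mult_right_mono[OF m(2), of "real l"] by linarith
        have "\<bar>(\<integral>x. x ^ l \<partial>\<mu>) - (\<integral>x. x ^ l \<partial>\<nu>)\<bar> = root l \<bar>(\<integral>x. x ^ l \<partial>\<mu>) - (\<integral>y. y ^ l \<partial>\<nu>)\<bar> ^ l"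
          using l by simp
        also have "\<dots> \<le> (m * real l) ^ l"
          using root l by (intro power_mono) auto
        finally show "\<bar>(\<integral>x. x ^ l \<partial>\<mu>) - (\<integral>x. x ^ l \<partial>\<nu>)\<bar> \<le> (m * real l) ^ l" .
      qed
      also have "27648 * p * m = 27648 * p * s + e"
        using p by (simp add: m_def field_simps)
      also have "ennreal \<dots> = ennreal (27648 * p) * S + ennreal e"
        using p e real by (simp add: ennreal_mult)
      finally show "wasserstein p \<mu> \<nu> \<le> ennreal (27648 * p) * S + ennreal e" .
    qed
  qed
qed

end
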